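(* Let $X$ be a quasi-convex metric space with quasi-convexity constant $C$ such that $\pi_1^{\mathrm{Lip}}(X)=0$, and let $Y$ be a purely $2$-unrectifiable metric space. Then every Lipschitz map $f:X\to Y$ factors through a metric tree: there exist a metric tree $Z$, a $C\,\mathrm{Lip}(f)$-Lipschitz map $\psi:X\to Z$ and a $1$-Lipschitz map $\varphi:Z\to Y$ with $f=\varphi\circ\psi$.
   Context: A metric space $(X,d)$ is quasi-convex with constant $C$ if any $x,x'\in X$ can be joined by a curve of length at most $C\,d(x,x')$. $\pi_1^{\mathrm{Lip}}(X)=0$ means every Lipschitz loop $S^1\to X$ extends to a Lipschitz map of the closed disc $D^2\to X$ (equivalently is Lipschitz null-homotopic). $Y$ is purely $2$-unrectifiable if $\mathcal{H}^2(\varrho(A))=0$ for every Borel set $A\subset\mathbb{R}^2$ and every Lipschitz map $\varrho:A\to Y$. A metric tree is a geodesic metric space in which every geodesic triangle is isometric to a tripod. *)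

theory Defs
  imports "HOL-Analysis.Analysis"
begin

definition curve_length :: "(real \<Rightarrow> 'a::metric_space) \<Rightarrow> real \<Rightarrow> real \<Rightarrow> ennreal" where
  "curve_length \<gamma> a b =
     (SUP np \<in> {(n, p::nat \<Rightarrow> real). p 0 = a \<and> p n = b \<and> (\<forall>i<n. p i \<le> p (Suc i))}.
        ennreal (\<Sum>i<fst np. dist (\<gamma> (snd np i)) (\<gamma> (snd np (Suc i)))))"

definition quasi_convex :: "real \<Rightarrow> 'a::metric_space itself \<Rightarrow> bool" where
  "quasi_convex C _ \<longleftrightarrow>
     (\<forall>x x'::'a. \<exists>\<gamma> a b. a \<le> b \<and> continuous_on {a..b} \<gamma> \<and> \<gamma> a = x \<and> \<gamma> b = x' \<and>
        curve_length \<gamma> a b \<le> ennreal (C * dist x x'))"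

(* pi_1^Lip(X) = 0 : every Lipschitz loop S^1 -> X extends to a Lipschitz map D^2 -> X
   (R^2 is modelled by the complex plane) *)
definition lip_simply_connected :: "'a::metric_space itself \<Rightarrow> bool" where
  "lip_simply_connected _ \<longleftrightarrow>
     (\<forall>(\<gamma>::complex \<Rightarrow> 'a) L. lipschitz_on L (sphere 0 1) \<gamma> \<longrightarrow>
        (\<exists>g L'. lipschitz_on L' (cball 0 1) g \<and> (\<forall>z\<in>sphere 0 1. g z = \<gamma> z)))"

(* Hausdorff measure H^s (normalisation constant taken to be 1) *)
definition hausdorff_pre :: "real \<Rightarrow> real \<Rightarrow> 'a::metric_space set \<Rightarrow> ennreal" where
  "hausdorff_pre s \<delta> E =
     (INF U \<in> {U::nat \<Rightarrow> 'a set. E \<subseteq> \<Union>(range U) \<and> (\<forall>i. bounded (U i) \<and> diameter (U i) \<le> \<delta>)}.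
        (\<Sum>i. ennreal (diameter (U i) powr s)))"

definition hausdorff_measure :: "real \<Rightarrow> 'a::metric_space set \<Rightarrow> ennreal" where
  "hausdorff_measure s E = (SUP \<delta> \<in> {0<..}. hausdorff_pre s \<delta> E)"

definition purely_2_unrectifiable :: "'b::metric_space itself \<Rightarrow> bool" where
  "purely_2_unrectifiable _ \<longleftrightarrow>
     (\<forall>(A::complex set) (\<rho>::complex \<Rightarrow> 'b) L. A \<in> sets borel \<longrightarrow> lipschitz_on L A \<rho> \<longrightarrow>
        hausdorff_measure 2 (\<rho> ` A) = 0)"

definition Lip :: "('a::metric_space \<Rightarrow> 'b::metric_space) \<Rightarrow> real" where
  "Lip f = Inf {L. lipschitz_on L UNIV f}"

definition geodesic_seg :: "'z set \<Rightarrow> ('z \<Rightarrow> 'z \<Rightarrow> real) \<Rightarrow> (real \<Rightarrow> 'z) \<Rightarrow> 'z \<Rightarrow> 'z \<Rightarrow> bool" where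
  "geodesic_seg Z d \<gamma> x y \<longleftrightarrow>
     \<gamma> ` {0..d x y} \<subseteq> Z \<and> \<gamma> 0 = x \<and> \<gamma> (d x y) = y \<and>
     (\<forall>s\<in>{0..d x y}. \<forall>t\<in>{0..d x y}. d (\<gamma> s) (\<gamma> t) = \<bar>s - t\<bar>)"

definition geodesic_space :: "'z set \<Rightarrow> ('z \<Rightarrow> 'z \<Rightarrow> real) \<Rightarrow> bool" where
  "geodesic_space Z d \<longleftrightarrow> Metric_space Z d \<and> (\<forall>x\<in>Z. \<forall>y\<in>Z. \<exists>\<gamma>. geodesic_seg Z d \<gamma> x y)"

(* tripod with legs of lengths a b c glued at the centre (0,0) *)
definition tripod :: "real \<Rightarrow> real \<Rightarrow> real \<Rightarrow> (nat \<times> real) set" where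
  "tripod a b c = {(i,t). (i = 0 \<and> 0 \<le> t \<and> t \<le> a) \<or> (i = 1 \<and> 0 < t \<and> t \<le> b) \<or> (i = 2 \<and> 0 < t \<and> t \<le> c)}"

definition tripod_dist :: "nat \<times> real \<Rightarrow> nat \<times> real \<Rightarrow> real" where
  "tripod_dist p q = (if fst p = fst q then \<bar>snd p - snd q\<bar> else snd p + snd q)"

definition metric_tree :: "'z set \<Rightarrow> ('z \<Rightarrow> 'z \<Rightarrow> real) \<Rightarrow> bool" where
  "metric_tree Z d \<longleftrightarrow> geodesic_space Z d \<and>
     (\<forall>x\<in>Z. \<forall>y\<in>Z. \<forall>z\<in>Z. \<forall>\<gamma>1 \<gamma>2 \<gamma>3.
        geodesic_seg Z d \<gamma>1 x y \<and> geodesic_seg Z d \<gamma>2 y z \<and> geodesic_seg Z d \<gamma>3 z x \<longrightarrow>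
        (let T = \<gamma>1 ` {0..d x y} \<union> \<gamma>2 ` {0..d y z} \<union> \<gamma>3 ` {0..d z x} in
         \<exists>a b c h. 0 \<le> a \<and> 0 \<le> b \<and> 0 \<le> c \<and> bij_betw h T (tripod a b c) \<and>
           (\<forall>p\<in>T. \<forall>q\<in>T. tripod_dist (h p) (h q) = d p q)))"

end

theory Submission
  imports Defs
begin

text \<open>Let \<open>height x\<close> be the cost of reaching \<open>x\<close> from a base point, where a path costs \<open>Lip f\<close> times
  its length and moving inside a connected subset of a fibre of \<open>f\<close> is free. Let \<open>meet x y\<close> be the
  supremum of the levels above which \<open>x\<close> and \<open>y\<close> can be joined. Since \<open>meet\<close> satisfies the
  ultrametric inequality, \<open>height x + height y - 2 * meet x y\<close> satisfies the four-point condition, and a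
  connected space with this condition is a metric tree. Quasi-convexity bounds this
  pseudo-metric from above by \<open>C * Lip f * dist x y\<close>; the point is that it dominates \<open>dist (f x) (f y)\<close>.

  Two nearly optimal paths from the base point to \<open>x\<close> and \<open>y\<close> and a path from \<open>x\<close> to \<open>y\<close> above
  level \<open>s\<close> form a loop, which is filled by a Lipschitz disc. For \<open>t < s\<close> some component of the level \<open>t\<close> of the
  height on the disc separates the base point from \<open>x\<close>, so it meets both optimal paths. If \<open>f\<close> nearly agrees at
  the two meeting points, the estimate follows. Otherwise this fails for infinitely many \<open>t\<close>, and two such
  components cross a common level component \<open>Q\<close> of a distance function on the image of \<open>f\<close>. As the
  image of the disc is \<open>H\<^sup>2\<close>-null, generic levels of the distance function are totally
  disconnected, so \<open>f\<close>, and hence the height, is constant on \<open>Q\<close>: the two levels coincide.\<close>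

section \<open>Four-point spaces are metric trees\<close>

lemma geodesic_seg_dist:
  assumes "geodesic_seg Z d \<gamma> x y" "0 \<le> s" "s \<le> d x y"
  shows "\<gamma> s \<in> Z" "d x (\<gamma> s) = s" "d (\<gamma> s) y = d x y - s"
proof -
  have 1: "\<gamma> 0 = x" "\<gamma> (d x y) = y" and 2: "\<And>s t. s \<in> {0..d x y} \<Longrightarrow> t \<in> {0..d x y} \<Longrightarrow> d (\<gamma> s) (\<gamma> t) = \<bar>s - t\<bar>"
    and 3: "\<gamma> ` {0..d x y} \<subseteq> Z"
    using assms(1) unfolding geodesic_seg_def by auto
  show "\<gamma> s \<in> Z" using 3 assms by auto
  show "d x (\<gamma> s) = s" using 2[of 0 s] 1 assms by auto
  show "d (\<gamma> s) y = d x y - s" using 2[of s "d x y"] 1 assms by auto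
qed

text \<open>The inequality \<open>four_point\<close> is Gromov's 0-hyperbolicity. The assumption
  \<open>between\<close> provides single points only and stands in for the existence of
  geodesics.\<close>

locale four_point_space = Metric_space Z d for Z :: "'z set" and d +
  assumes four_point: "\<lbrakk>x \<in> Z; y \<in> Z; z \<in> Z; w \<in> Z\<rbrakk> \<Longrightarrow> d x y + d z w \<le> max (d x z + d y w) (d x w + d y z)"
    and between: "\<lbrakk>x \<in> Z; y \<in> Z; 0 \<le> s; s \<le> d x y\<rbrakk> \<Longrightarrow> \<exists>z\<in>Z. d x z = s \<and> d z y = d x y - s"
begin

text \<open>Points chosen independently by \<open>between\<close> already form a geodesic:
  \<open>four_point\<close> against both end points gives
  \<open>d (\<gamma> s) (\<gamma> t) \<le> \<bar>s - t\<bar>\<close>, and the triangle inequality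
  gives the converse.\<close>

lemma geodesic_space: "geodesic_space Z d"
  unfolding geodesic_space_def
proof (intro conjI ballI)
  show "Metric_space Z d" by unfold_locales
  fix x y assume xy: "x \<in> Z" "y \<in> Z"
  define \<gamma> where "\<gamma> s = (SOME z. z \<in> Z \<and> d x z = s \<and> d z y = d x y - s)" for s
  have \<gamma>: "\<gamma> s \<in> Z" "d x (\<gamma> s) = s" "d (\<gamma> s) y = d x y - s" if "s \<in> {0..d x y}" for s
    using someI_ex[of "\<lambda>z. z \<in> Z \<and> d x z = s \<and> d z y = d x y - s"] between[OF xy, of s] that
    unfolding \<gamma>_def by auto
  have "d (\<gamma> s) (\<gamma> t) = \<bar>s - t\<bar>" if "s \<in> {0..d x y}" "t \<in> {0..d x y}" for s t
    using four_point[OF \<gamma>(1)[OF that(1)] \<gamma>(1)[OF that(2)] xy]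
      triangle[OF xy(1) \<gamma>(1)[OF that(1)] \<gamma>(1)[OF that(2)]] triangle[OF xy(1) \<gamma>(1)[OF that(2)] \<gamma>(1)[OF that(1)]]
      \<gamma>(2,3)[OF that(1)] \<gamma>(2,3)[OF that(2)]
      commute[of "\<gamma> s" "\<gamma> t"] commute[of x] by (auto simp: max_def split: if_splits)
  moreover have "\<gamma> 0 = x" using \<gamma>(1,2)[of 0] xy by simp
  moreover have "\<gamma> (d x y) = y" using \<gamma>(1,3)[of "d x y"] xy by simp
  ultimately have "geodesic_seg Z d \<gamma> x y"
    unfolding geodesic_seg_def using \<gamma>(1) by auto
  then show "\<exists>\<gamma>. geodesic_seg Z d \<gamma> x y" by blast
qed

text \<open>The Gromov product of \<open>y\<close> and \<open>z\<close> at \<open>x\<close>: the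
  length of the leg at \<open>x\<close> of the comparison tripod.\<close>

definition gromov :: "'z \<Rightarrow> 'z \<Rightarrow> 'z \<Rightarrow> real" where
  "gromov x y z = (d x y + d x z - d y z) / 2"

text \<open>Here \<open>t\<close> is the distance from the centre of the tripod. A leg is encoded by
  the distances to the corners, without naming a centre in \<open>Z\<close>; at \<open>t = 0\<close>
  the three legs agree.\<close>

definition on_leg :: "'z \<Rightarrow> 'z \<Rightarrow> 'z \<Rightarrow> 'z \<Rightarrow> real \<Rightarrow> bool" where
  "on_leg x y z p t \<longleftrightarrow> p \<in> Z \<and> 0 \<le> t \<and> t \<le> gromov x y z \<and> d p x = gromov x y z - t \<and>
     d p y = gromov y z x + t \<and> d p z = gromov z x y + t"

lemma gromov_sum: "x \<in> Z \<Longrightarrow> y \<in> Z \<Longrightarrow> gromov x y z + gromov y z x = d x y"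
  unfolding gromov_def by (simp add: commute field_simps)

lemma gromov_commute: "gromov x y z = gromov x z y"
  unfolding gromov_def by (simp add: commute)

lemma gromov_nonneg: "x \<in> Z \<Longrightarrow> y \<in> Z \<Longrightarrow> z \<in> Z \<Longrightarrow> 0 \<le> gromov x y z"
  using triangle[of y x z] unfolding gromov_def by (simp add: commute)

lemma on_leg_swap: "on_leg x y z p t \<longleftrightarrow> on_leg x z y p t"
  unfolding on_leg_def by (auto simp: gromov_commute)

text \<open>Here and in the next lemma \<open>four_point\<close> with \<open>x\<close> and
  \<open>y\<close> gives the upper bound, and the triangle inequality through a corner the lower
  one.\<close>

lemma on_leg_dist_same:
  assumes "x \<in> Z" "y \<in> Z" "z \<in> Z" "on_leg x y z p t" "on_leg x y z q u"
  shows "d p q = \<bar>t - u\<bar>"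
proof -
  have pq: "p \<in> Z" "q \<in> Z" using assms unfolding on_leg_def by auto
  show ?thesis
    using four_point[OF pq assms(1,2)] triangle[OF pq assms(1)] triangle[of q p x] pq assms
      gromov_sum[of x y z] commute[of p q]
    unfolding on_leg_def by auto
qed

lemma on_leg_dist_different:
  assumes "x \<in> Z" "y \<in> Z" "z \<in> Z" "on_leg x y z p t" "on_leg y z x q u"
  shows "d p q = t + u"
proof -
  have pq: "p \<in> Z" "q \<in> Z" using assms unfolding on_leg_def by auto
  show ?thesis
    using four_point[OF pq assms(1,2)] triangle[OF pq assms(2)] pq assms
      gromov_sum[of x y z] commute[of p q]
    unfolding on_leg_def by auto
qed

text \<open>Up to the branching point, \<open>four_point\<close> determines the distance to
  \<open>z\<close> from those to \<open>x\<close> and \<open>y\<close>.\<close>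

lemma on_leg_between:
  assumes xyz: "x \<in> Z" "y \<in> Z" "z \<in> Z" and p: "p \<in> Z" "d x p = s" "d p y = d x y - s" "0 \<le> s"
    and s: "s \<le> gromov x y z"
  shows "on_leg x y z p (gromov x y z - s)"
proof -
  have "d p z = d x z - s"
    using four_point[OF p(1) xyz(3) xyz(1,2)] triangle[OF xyz(1) p(1) xyz(3)] s p
    unfolding gromov_def by (simp add: commute max_def split: if_splits)
  then show ?thesis
    using p s unfolding on_leg_def gromov_def by (simp add: commute field_simps)
qed

text \<open>A side runs along the leg of \<open>x\<close> to the centre and then along the leg of
  \<open>y\<close>; the second half is the first one read from \<open>y\<close>.\<close>

lemma seg_on_leg:
  assumes xyz: "x \<in> Z" "y \<in> Z" "z \<in> Z" and \<gamma>: "geodesic_seg Z d \<gamma> x y" and s: "0 \<le> s" "s \<le> d x y"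
  shows "s \<le> gromov x y z \<Longrightarrow> on_leg x y z (\<gamma> s) (gromov x y z - s)"
    and "gromov x y z \<le> s \<Longrightarrow> on_leg y z x (\<gamma> s) (s - gromov x y z)"
proof -
  note g = geodesic_seg_dist[OF \<gamma> s]
  show "s \<le> gromov x y z \<Longrightarrow> on_leg x y z (\<gamma> s) (gromov x y z - s)"
    using on_leg_between[OF xyz g] s by simp
  have "gromov y x z = d x y - gromov x y z"
    using gromov_sum[of x y z] gromov_commute[of y x z] xyz by simp
  then show "on_leg y z x (\<gamma> s) (s - gromov x y z)" if "gromov x y z \<le> s"
    using on_leg_between[of y x z "\<gamma> s" "d x y - s"] xyz g s that
    by (subst on_leg_swap) (simp add: commute)
qed

lemma triangle_tripod:
  assumes xyz: "x \<in> Z" "y \<in> Z" "z \<in> Z"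
    and g: "geodesic_seg Z d \<gamma>1 x y" "geodesic_seg Z d \<gamma>2 y z" "geodesic_seg Z d \<gamma>3 z x"
    and T: "T = \<gamma>1 ` {0..d x y} \<union> \<gamma>2 ` {0..d y z} \<union> \<gamma>3 ` {0..d z x}"
  shows "\<exists>a b c h. 0 \<le> a \<and> 0 \<le> b \<and> 0 \<le> c \<and> bij_betw h T (tripod a b c) \<and>
           (\<forall>p\<in>T. \<forall>q\<in>T. tripod_dist (h p) (h q) = d p q)"
proof -
  define a where "a = gromov x y z"
  define b where "b = gromov y z x"
  define c where "c = gromov z x y"
  have abc: "0 \<le> a" "0 \<le> b" "0 \<le> c"
    unfolding a_def b_def c_def using xyz by (auto intro: gromov_nonneg)
  have sums: "d x y = a + b" "d y z = b + c" "d z x = c + a"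
    unfolding a_def b_def c_def using gromov_sum xyz by auto
  \<comment> \<open>The leg of \<open>p\<close> is recognised from its distances to the corners. The
    non-strict first test sends the centre to \<open>(0, 0)\<close>, matching \<open>tripod\<close>,
    where legs 1 and 2 omit the parameter 0.\<close>
  define h :: "'z \<Rightarrow> nat \<times> real" where
    "h p = (if d p x \<le> a then (0, a - d p x) else if d p y < b then (1, b - d p y) else (2, c - d p z))" for p
  have hx: "h p = (0, t)" if "on_leg x y z p t" for p t
    using that unfolding on_leg_def h_def a_def by auto
  have hy: "h p = (if t = 0 then (0, 0) else (1, t))" if "on_leg y z x p t" for p t
    using that unfolding on_leg_def h_def a_def b_def by auto
  have hz: "h p = (if t = 0 then (0, 0) else (2, t))" if "on_leg z x y p t" for p t
    using that unfolding on_leg_def h_def a_def b_def c_def by auto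
  have legs: "(\<exists>t. on_leg x y z p t) \<or> (\<exists>t. on_leg y z x p t) \<or> (\<exists>t. on_leg z x y p t)" if pT: "p \<in> T" for p
  proof -
    consider s where "p = \<gamma>1 s" "0 \<le> s" "s \<le> d x y" | s where "p = \<gamma>2 s" "0 \<le> s" "s \<le> d y z"
      | s where "p = \<gamma>3 s" "0 \<le> s" "s \<le> d z x"
      using pT T by auto
    then show ?thesis
    proof cases
      case (1 s) then show ?thesis using seg_on_leg[OF xyz g(1), of s] by (meson linear)
    next
      case (2 s) then show ?thesis using seg_on_leg[OF xyz(2,3,1) g(2), of s] by (meson linear)
    next
      case (3 s) then show ?thesis using seg_on_leg[OF xyz(3,1,2) g(3), of s] by (meson linear)
    qed
  qed
  have cases: thesis
    if "p \<in> T" and "\<And>t. on_leg x y z p t \<Longrightarrow> 0 \<le> t \<Longrightarrow> t \<le> a \<Longrightarrow> h p = (0, t) \<Longrightarrow> thesis"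
      and "\<And>t. on_leg y z x p t \<Longrightarrow> 0 \<le> t \<Longrightarrow> t \<le> b \<Longrightarrow> h p = (if t = 0 then (0, 0) else (1, t)) \<Longrightarrow> thesis"
      and "\<And>t. on_leg z x y p t \<Longrightarrow> 0 \<le> t \<Longrightarrow> t \<le> c \<Longrightarrow> h p = (if t = 0 then (0, 0) else (2, t)) \<Longrightarrow> thesis"
    for p thesis
    using legs[OF that(1)] that(2-) hx hy hz unfolding on_leg_def a_def b_def c_def by blast
  have in_tripod: "h p \<in> tripod a b c" if "p \<in> T" for p
    using that by (rule cases) (use abc in \<open>auto simp: tripod_def\<close>)
  have dist: "tripod_dist (h p) (h q) = d p q" if "p \<in> T" "q \<in> T" for p q
  proof -
    note same = on_leg_dist_same[OF xyz] on_leg_dist_same[OF xyz(2,3,1)] on_leg_dist_same[OF xyz(3,1,2)]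
    note diff = on_leg_dist_different[OF xyz] on_leg_dist_different[OF xyz(2,3,1)] on_leg_dist_different[OF xyz(3,1,2)]
    \<comment> \<open>\<open>on_leg_dist_different\<close> covers legs in cyclic order; the reversed
      pairs need symmetry.\<close>
    note diff' = diff[THEN trans[OF commute]]
    from \<open>p \<in> T\<close> show ?thesis
    proof (rule cases)
      fix t assume t: "on_leg x y z p t" "0 \<le> t" "h p = (0, t)"
      from \<open>q \<in> T\<close> show ?thesis
        by (rule cases) (use t same(1)[OF t(1)] diff(1)[OF t(1)] diff'(3)[OF _ t(1)] in \<open>auto simp: tripod_dist_def\<close>)
    next
      fix t assume t: "on_leg y z x p t" "0 \<le> t" "h p = (if t = 0 then (0, 0) else (1, t))"
      from \<open>q \<in> T\<close> show ?thesis
        by (rule cases) (use t same(2)[OF t(1)] diff(2)[OF t(1)] diff'(1)[OF _ t(1)] in \<open>auto simp: tripod_dist_def\<close>)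
    next
      fix t assume t: "on_leg z x y p t" "0 \<le> t" "h p = (if t = 0 then (0, 0) else (2, t))"
      from \<open>q \<in> T\<close> show ?thesis
        by (rule cases) (use t same(3)[OF t(1)] diff(3)[OF t(1)] diff'(2)[OF _ t(1)] in \<open>auto simp: tripod_dist_def\<close>)
    qed
  qed
  have TZ: "T \<subseteq> Z" using g T unfolding geodesic_seg_def by auto
  have inj: "inj_on h T"
  proof (rule inj_onI)
    fix p q assume "p \<in> T" "q \<in> T" "h p = h q"
    then have "d p q = 0" using dist[of p q] by (simp add: tripod_dist_def)
    then show "p = q" using TZ \<open>p \<in> T\<close> \<open>q \<in> T\<close> by (simp add: subset_iff)
  qed
  \<comment> \<open>Each leg is swept out by the initial part of the side starting at its
    corner.\<close>
  have surj: "r \<in> h ` T" if r: "r \<in> tripod a b c" for r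
  proof -
    obtain i t where it: "r = (i, t)" by fastforce
    consider "i = 0" "0 \<le> t" "t \<le> a" | "i = 1" "0 < t" "t \<le> b" | "i = 2" "0 < t" "t \<le> c"
      using r it unfolding tripod_def by auto
    then show ?thesis
    proof cases
      case 1
      then have "h (\<gamma>1 (a - t)) = r"
        using seg_on_leg(1)[OF xyz g(1), of "a - t"] sums abc it unfolding a_def by (intro trans[OF hx]) auto
      then show ?thesis using 1 sums abc T by (intro image_eqI[of _ _ "\<gamma>1 (a - t)"]) auto
    next
      case 2
      then have "on_leg y z x (\<gamma>2 (b - t)) t"
        using seg_on_leg(1)[OF xyz(2,3,1) g(2), of "b - t"] sums abc unfolding b_def by auto
      then have "h (\<gamma>2 (b - t)) = r" using 2 it hy by auto
      then show ?thesis using 2 sums abc T by (intro image_eqI[of _ _ "\<gamma>2 (b - t)"]) auto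
    next
      case 3
      then have "on_leg z x y (\<gamma>3 (c - t)) t"
        using seg_on_leg(1)[OF xyz(3,1,2) g(3), of "c - t"] sums abc unfolding c_def by auto
      then have "h (\<gamma>3 (c - t)) = r" using 3 it hz by auto
      then show ?thesis using 3 sums abc T by (intro image_eqI[of _ _ "\<gamma>3 (c - t)"]) auto
    qed
  qed
  have "bij_betw h T (tripod a b c)"
    unfolding bij_betw_def using inj in_tripod surj by blast
  then show ?thesis using abc dist by blast
qed

theorem metric_tree: "metric_tree Z d"
  unfolding metric_tree_def Let_def
  using geodesic_space triangle_tripod by blast

end

section \<open>Lipschitz paths in quasi-convex spaces\<close>

text \<open>The infimum is attained, since every difference quotient is a lower bound for the
  admissible constants.\<close>

lemma lipschitz_on_Lip:
  fixes f :: "'a::metric_space \<Rightarrow> 'b::metric_space"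
  assumes "\<exists>L. lipschitz_on L UNIV f"
  shows "lipschitz_on (Lip f) UNIV f"
proof (rule lipschitz_onI)
  let ?S = "{L. lipschitz_on L UNIV f}"
  have ne: "?S \<noteq> {}" using assms by auto
  show "0 \<le> Lip f" unfolding Lip_def
    using ne by (intro cInf_greatest) (auto dest: lipschitz_on_nonneg)
  fix x y
  show "dist (f x) (f y) \<le> Lip f * dist x y"
  proof (cases "x = y")
    case False
    then have "dist (f x) (f y) / dist x y \<le> Lip f" unfolding Lip_def
      using ne by (intro cInf_greatest) (auto simp: pos_divide_le_eq dest: lipschitz_onD)
    then show ?thesis using False by (simp add: pos_divide_le_eq)
  qed simp
qed

lemma curve_length_ge_partition:
  assumes "p 0 = a" "p n = b" "\<And>i. i < n \<Longrightarrow> p i \<le> p (Suc i)"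
  shows "ennreal (\<Sum>i<n. dist (\<gamma> (p i)) (\<gamma> (p (Suc i)))) \<le> curve_length \<gamma> a b"
  unfolding curve_length_def
  by (rule SUP_upper2[of "(n, p)"]) (use assms in auto)

text \<open>Any partition of \<open>{a..s}\<close> can be extended by the point
  \<open>t\<close>.\<close>

lemma curve_length_superadd:
  assumes "a \<le> s" "s \<le> t"
  shows "curve_length \<gamma> a s + ennreal (dist (\<gamma> s) (\<gamma> t)) \<le> curve_length \<gamma> a t"
proof -
  have ne: "{(n, p::nat \<Rightarrow> real). p 0 = a \<and> p n = s \<and> (\<forall>i<n. p i \<le> p (Suc i))} \<noteq> {}"
  proof -
    have "(1, \<lambda>i::nat. if i = 0 then a else s) \<in> {(n, p::nat \<Rightarrow> real). p 0 = a \<and> p n = s \<and> (\<forall>i<n. p i \<le> p (Suc i))}"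
      using assms by auto
    then show ?thesis by blast
  qed
  show ?thesis
    unfolding curve_length_def[of \<gamma> a s]
  proof (subst ennreal_SUP_add_left[OF ne, symmetric], rule SUP_least, clarsimp)
    fix n :: nat and p :: "nat \<Rightarrow> real"
    assume p: "a = p 0" "s = p n" "\<forall>i<n. p i \<le> p (Suc i)"
    define q where "q = p(Suc n := t)"
    have "(\<Sum>i<n. dist (\<gamma> (p i)) (\<gamma> (p (Suc i)))) + dist (\<gamma> s) (\<gamma> t)
        = (\<Sum>i<Suc n. dist (\<gamma> (q i)) (\<gamma> (q (Suc i))))"
      using p unfolding q_def by simp
    moreover have "ennreal \<dots> \<le> curve_length \<gamma> a t"
      using p assms by (intro curve_length_ge_partition) (auto simp: q_def less_Suc_eq)
    ultimately show "ennreal (\<Sum>i<n. dist (\<gamma> (p i)) (\<gamma> (p (Suc i)))) + ennreal (dist (\<gamma> (p n)) (\<gamma> t))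
        \<le> curve_length \<gamma> (p 0) t"
      using p by (simp add: sum_nonneg flip: ennreal_plus)
  qed
qed

text \<open>The arc length function \<open>s\<close> need not be known to be continuous: the curve
  \<open>\<lambda>u. \<gamma> (sup {t. s t \<le> u})\<close> is constant across any jump of \<open>s\<close>.\<close>

lemma lipschitz_reparametrization:
  fixes \<gamma> :: "real \<Rightarrow> 'a::metric_space"
  assumes ab: "a \<le> b" and cont: "continuous_on {a..b} \<gamma>" and L: "curve_length \<gamma> a b \<le> ennreal L" "0 \<le> L"
  obtains \<delta> where "lipschitz_on 1 {0..L} \<delta>" "\<delta> 0 = \<gamma> a" "\<delta> L = \<gamma> b"
proof -
  define s where "s t = enn2real (curve_length \<gamma> a t)" for t
  have mono: "curve_length \<gamma> a t \<le> curve_length \<gamma> a t'" if "a \<le> t" "t \<le> t'" for t t'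
    by (rule order_trans[OF _ curve_length_superadd[OF that]]) (simp add: add_increasing2)
  have fin: "curve_length \<gamma> a t < top" if "a \<le> t" "t \<le> b" for t
    using mono[OF that] L by (meson ennreal_less_top order_le_less_trans order_trans)
  have s: "dist (\<gamma> t) (\<gamma> t') \<le> s t' - s t" if "a \<le> t" "t \<le> t'" "t' \<le> b" for t t'
  proof -
    have "ennreal (s t + dist (\<gamma> t) (\<gamma> t')) \<le> ennreal (s t')"
      using curve_length_superadd[of a t t' \<gamma>] fin[of t] fin[of t'] that
      by (simp add: s_def)
    moreover have "0 \<le> s t'" by (simp add: s_def)
    ultimately show ?thesis by simp
  qed
  have sL: "s t \<le> L" if "a \<le> t" "t \<le> b" for t
    using mono[OF that] L unfolding s_def by (intro enn2real_leI) auto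
  have sa: "s a = 0"
  proof -
    have "curve_length \<gamma> a a = 0" unfolding curve_length_def
    proof (rule antisym[OF SUP_least])
      fix np :: "nat \<times> (nat \<Rightarrow> real)"
      assume "np \<in> {(n, p). p 0 = a \<and> p n = a \<and> (\<forall>i<n. p i \<le> p (Suc i))}"
      then obtain n p where np: "np = (n, p)" and p: "a = p 0" "p n = p 0" "\<forall>i<n. p i \<le> p (Suc i)" by auto
      have le: "p i \<le> p j" if "i \<le> j" "j \<le> n" for i j
        using that
      proof (induction j rule: dec_induct)
        case (step k)
        then show ?case using p(3)[rule_format, of k] by simp
      qed simp
      have eq: "p i = p 0" if "i \<le> n" for i
        using le[OF le0 that] le[OF that order_refl] unfolding p(2) by linarith
      have "(\<Sum>i<n. dist (\<gamma> (p i)) (\<gamma> (p (Suc i)))) = (\<Sum>i<n. 0)"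
      proof (rule sum.cong[OF refl])
        fix i assume "i \<in> {..<n}"
        then show "dist (\<gamma> (p i)) (\<gamma> (p (Suc i))) = 0" using eq[of i] eq[of "Suc i"] by simp
      qed
      then show "ennreal (\<Sum>i<fst np. dist (\<gamma> (snd np i)) (\<gamma> (snd np (Suc i)))) \<le> 0" by (simp add: np)
    qed simp
    then show ?thesis by (simp add: s_def)
  qed
  define T where "T u = {t \<in> {a..b}. s t \<le> u}" for u
  have T: "a \<in> T u" "bdd_above (T u)" "T u \<subseteq> {a..b}" if "0 \<le> u" for u
    using that sa ab unfolding T_def by (auto intro!: bdd_aboveI[of _ b])
  define \<tau> where "\<tau> u = Sup (T u)" for u
  have \<tau>: "a \<le> \<tau> u" "\<tau> u \<le> b" if "0 \<le> u" for u
    using T[OF that] unfolding \<tau>_def by (auto intro: cSup_upper intro!: cSup_least)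
  have close: "\<exists>d>0. \<forall>t\<in>{a..b}. \<bar>t - \<tau> u\<bar> < d \<longrightarrow> dist (\<gamma> t) (\<gamma> (\<tau> u)) < e" if "0 \<le> u" "0 < e" for u e
    using cont[unfolded continuous_on_iff, rule_format, of "\<tau> u" e] \<tau>[OF that(1)] that(2)
    by (auto simp: dist_real_def)
  have lip: "dist (\<gamma> (\<tau> u)) (\<gamma> (\<tau> v)) \<le> v - u" if uv: "0 \<le> u" "u \<le> v" for u v
  proof (cases "\<tau> u = \<tau> v")
    case True then show ?thesis using uv by simp
  next
    case False
    have "\<tau> u \<le> \<tau> v" unfolding \<tau>_def using T uv by (intro cSup_subset_mono) (auto simp: T_def)
    then have lt: "\<tau> u < \<tau> v" using False by simp
    show ?thesis
    proof (rule field_le_epsilon)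
      fix e :: real assume "0 < e"
      obtain d where d: "d > 0" "\<And>t. t \<in> {a..b} \<Longrightarrow> \<bar>t - \<tau> u\<bar> < d \<Longrightarrow> dist (\<gamma> t) (\<gamma> (\<tau> u)) < e/2"
        using close[of u "e/2"] uv \<open>0 < e\<close> by auto
      obtain d' where d': "d' > 0" "\<And>t. t \<in> {a..b} \<Longrightarrow> \<bar>t - \<tau> v\<bar> < d' \<Longrightarrow> dist (\<gamma> t) (\<gamma> (\<tau> v)) < e/2"
        using close[of v "e/2"] uv \<open>0 < e\<close> by auto
      \<comment> \<open>\<open>r\<close> lies just after \<open>\<tau> u\<close>, so
        \<open>s r > u\<close>; \<open>r'\<close> lies at or just before \<open>\<tau> v\<close>
        with \<open>s r' \<le> v\<close>. Thus \<open>\<gamma>\<close> moves by less than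
        \<open>v - u\<close> between them, and continuity absorbs the two ends.\<close>
      define r where "r = min (\<tau> u + d/2) ((\<tau> u + \<tau> v) / 2)"
      have r: "\<tau> u < r" "r < \<tau> v" "\<bar>r - \<tau> u\<bar> < d" unfolding r_def using d(1) lt by (auto simp: min_def)
      have "max r (\<tau> v - d') < Sup (T v)" using r d'(1) unfolding \<tau>_def[symmetric] by auto
      then obtain r' where r': "r' \<in> T v" "max r (\<tau> v - d') < r'"
        using less_cSupE[of "max r (\<tau> v - d')" "T v"] T(1)[of v] uv by auto
      have "r' \<le> \<tau> v" unfolding \<tau>_def using r' T[of v] uv by (intro cSup_upper) auto
      have rI: "r \<in> {a..b}" "r' \<in> {a..b}" using r r' \<tau>[of u] \<tau>[of v] uv by (auto simp: T_def)
      have "r \<notin> T u" using r(1) T(2)[of u] uv unfolding \<tau>_def by (auto dest: cSup_upper)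
      then have "u < s r" using rI by (auto simp: T_def)
      moreover have "s r' \<le> v" using r' by (auto simp: T_def)
      moreover have "dist (\<gamma> r) (\<gamma> r') \<le> s r' - s r" using s[of r r'] rI r' by auto
      moreover have "dist (\<gamma> r) (\<gamma> (\<tau> u)) < e/2" using d(2) rI r by auto
      moreover have "dist (\<gamma> r') (\<gamma> (\<tau> v)) < e/2" using d'(2) rI r' \<open>r' \<le> \<tau> v\<close> by auto
      moreover have "dist (\<gamma> (\<tau> u)) (\<gamma> (\<tau> v)) \<le> dist (\<gamma> r) (\<gamma> (\<tau> u)) + dist (\<gamma> r) (\<gamma> r') + dist (\<gamma> r') (\<gamma> (\<tau> v))"
        by metric
      ultimately show "dist (\<gamma> (\<tau> u)) (\<gamma> (\<tau> v)) \<le> v - u + e" by linarith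
    qed
  qed
  have "lipschitz_on 1 {0..L} (\<gamma> \<circ> \<tau>)"
  proof (rule lipschitz_onI)
    fix u v assume "u \<in> {0..L}" "v \<in> {0..L}"
    then show "dist ((\<gamma> \<circ> \<tau>) u) ((\<gamma> \<circ> \<tau>) v) \<le> 1 * dist u v"
      using lip[of u v] lip[of v u] by (cases "u \<le> v") (auto simp: dist_real_def dist_commute)
  qed simp
  \<comment> \<open>\<open>\<tau> 0\<close> exceeds \<open>a\<close> if \<open>\<gamma>\<close>
    starts with a constant piece, but zero arc length keeps the value
    \<open>\<gamma> a\<close>.\<close>
  moreover have "\<gamma> (\<tau> 0) = \<gamma> a"
  proof -
    have "dist (\<gamma> a) (\<gamma> (\<tau> 0)) \<le> 0"
    proof (rule field_le_epsilon)
      fix e :: real assume "0 < e"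
      obtain d where d: "d > 0" "\<And>t. t \<in> {a..b} \<Longrightarrow> \<bar>t - \<tau> 0\<bar> < d \<Longrightarrow> dist (\<gamma> t) (\<gamma> (\<tau> 0)) < e"
        using close[of 0 e] \<open>0 < e\<close> by auto
      obtain r where r: "r \<in> T 0" "\<tau> 0 - d < r"
        using less_cSupE[of "\<tau> 0 - d" "T 0"] T(1)[of 0] d(1) unfolding \<tau>_def by auto
      have "r \<le> \<tau> 0" unfolding \<tau>_def using r T[of 0] by (intro cSup_upper) auto
      have rI: "r \<in> {a..b}" "s r \<le> 0" using r by (auto simp: T_def)
      have "dist (\<gamma> a) (\<gamma> r) \<le> s r - s a" using s rI by simp
      then have "dist (\<gamma> a) (\<gamma> r) \<le> 0" using rI(2) sa by linarith
      moreover have "dist (\<gamma> r) (\<gamma> (\<tau> 0)) < e" using d(2) rI r \<open>r \<le> \<tau> 0\<close> by auto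
      ultimately show "dist (\<gamma> a) (\<gamma> (\<tau> 0)) \<le> 0 + e" using dist_triangle[of "\<gamma> a" "\<gamma> (\<tau> 0)" "\<gamma> r"] by linarith
    qed
    then show ?thesis by simp
  qed
  moreover have "\<tau> L = b"
  proof (rule antisym)
    show "\<tau> L \<le> b" using \<tau> L by simp
    show "b \<le> \<tau> L" unfolding \<tau>_def using sL ab T[OF L(2)] by (intro cSup_upper) (auto simp: T_def)
  qed
  ultimately show ?thesis using that[of "\<gamma> \<circ> \<tau>"] by simp
qed

lemma quasi_convex_lipschitz_path:
  fixes x y :: "'a::metric_space"
  assumes "quasi_convex C TYPE('a)"
  obtains \<gamma> :: "real \<Rightarrow> 'a" where "lipschitz_on (C * dist x y) {0..1} \<gamma>" "\<gamma> 0 = x" "\<gamma> 1 = y"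
proof -
  obtain \<gamma> a b where \<gamma>: "a \<le> b" "continuous_on {a..b} \<gamma>" "\<gamma> a = x" "\<gamma> b = y"
      "curve_length \<gamma> a b \<le> ennreal (C * dist x y)"
    using assms unfolding quasi_convex_def by blast
  \<comment> \<open>The sign of \<open>C\<close> is not given, and \<open>ennreal\<close> sends
    negative numbers to 0. For \<open>x \<noteq> y\<close> the length is positive, which forces
    \<open>C * dist x y\<close> to be positive.\<close>
  have "ennreal (dist x y) \<le> ennreal (C * dist x y)"
    using order_trans[OF add_increasing[OF zero_le order_refl] order_trans[OF curve_length_superadd[of a a b \<gamma>] \<gamma>(5)]] \<gamma>
    by simp
  then have nn: "0 \<le> C * dist x y"
    by (cases "x = y") (auto simp: ennreal_le_iff2 intro: order_trans[OF zero_le_dist])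
  obtain \<delta> where \<delta>: "lipschitz_on 1 {0..C * dist x y} \<delta>" "\<delta> 0 = x" "\<delta> (C * dist x y) = y"
    using lipschitz_reparametrization[OF \<gamma>(1,2,5) nn] \<gamma> by metis
  define l where "l = C * dist x y"
  note \<delta> = \<delta>[folded l_def] and nn = nn[folded l_def]
  show thesis
  proof (rule that[folded l_def, of "\<lambda>t. \<delta> (l * t)"])
    show "lipschitz_on (l) {0..1} (\<lambda>t. \<delta> (l * t))"
    proof (rule lipschitz_onI[OF _ nn])
      fix s t :: real assume "s \<in> {0..1}" "t \<in> {0..1}"
      then have "l * s \<in> {0..l}" "l * t \<in> {0..l}"
        using nn by (auto simp: mult_left_le)
      from lipschitz_onD[OF \<delta>(1) this]
      show "dist (\<delta> (l * s)) (\<delta> (l * t)) \<le> l * dist s t"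
        using nn by (simp add: dist_real_def abs_mult flip: right_diff_distrib)
    qed
  qed (use \<delta> in auto)
qed

section \<open>Null sets for the two-dimensional Hausdorff measure\<close>

text \<open>A piece of diameter \<open>D\<close> is mapped into a square of side
  \<open>2 * D\<close>, of area four times \<open>D\<close> squared, so the planar measure is at
  most four times any covering sum.\<close>

lemma hausdorff_null_imp_planar_null:
  fixes u v :: "'b::metric_space \<Rightarrow> real"
  assumes null: "hausdorff_measure 2 E = 0"
    and u: "\<And>x y. \<bar>u x - u y\<bar> \<le> dist x y" and v: "\<And>x y. \<bar>v x - v y\<bar> \<le> dist x y"
    and meas: "(\<lambda>w. (u w, v w)) ` E \<in> sets borel"
  shows "(\<lambda>w. (u w, v w)) ` E \<in> null_sets lborel"
proof -
  let ?S = "(\<lambda>w. (u w, v w)) ` E"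
  have pre: "hausdorff_pre 2 1 E = 0"
    using SUP_upper[of 1 "{0<..}" "\<lambda>\<delta>. hausdorff_pre 2 \<delta> E"] null
    unfolding hausdorff_measure_def by (simp add: bot_unique[symmetric] bot_ennreal)
  have bound: "emeasure lborel ?S \<le> 4 * ennreal e" if "0 < e" for e
  proof -
    have "hausdorff_pre 2 1 E < ennreal e" using pre that by simp
    then obtain U :: "nat \<Rightarrow> 'b set" where U: "E \<subseteq> \<Union>(range U)" "\<And>i. bounded (U i)"
        "(\<Sum>i. ennreal (diameter (U i) powr 2)) < ennreal e"
      unfolding hausdorff_pre_def INF_less_iff by auto
    define w where "w i = (SOME w. w \<in> U i)" for i
    have w: "w i \<in> U i" if "x \<in> U i" for x i using that unfolding w_def by (rule someI)
    define D where "D i = diameter (U i)" for i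
    have D: "0 \<le> D i" for i unfolding D_def using diameter_ge_0[OF U(2)] .
    define B where "B i = cbox (u (w i) - D i, v (w i) - D i) (u (w i) + D i, v (w i) + D i)" for i
    have "?S \<subseteq> (\<Union>i. B i)"
    proof clarify
      fix x assume "x \<in> E"
      then obtain i where i: "x \<in> U i" using U(1) by auto
      have "dist (w i) x \<le> D i" unfolding D_def using diameter_bounded_bound[OF U(2) w[OF i] i] .
      then have "(u x, v x) \<in> B i"
        using u[of x "w i"] v[of x "w i"] unfolding B_def by (auto simp: cbox_Pair_eq dist_commute abs_le_iff)
      then show "(u x, v x) \<in> (\<Union>i. B i)" by blast
    qed
    then have "emeasure lborel ?S \<le> emeasure lborel (\<Union>i. B i)"
      by (intro emeasure_mono) (auto simp: B_def)
    also have "\<dots> \<le> (\<Sum>i. emeasure lborel (B i))"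
      by (intro emeasure_subadditive_countably) (auto simp: B_def)
    also have "\<dots> = (\<Sum>i. 4 * ennreal (D i powr 2))"
    proof (intro suminf_cong)
      fix i
      have "emeasure lborel (B i) = ennreal (measure lborel (B i))"
        unfolding B_def
        by (intro emeasure_eq_ennreal_measure less_imp_neq[OF emeasure_lborel_cbox_finite[unfolded infinity_ennreal_def]])
      also have "measure lborel (B i) = 4 * D i powr 2"
        using D[of i] unfolding B_def content_Pair by (simp add: power2_eq_square)
      finally show "emeasure lborel (B i) = 4 * ennreal (D i powr 2)"
        by (simp add: ennreal_mult)
    qed
    also have "\<dots> = 4 * (\<Sum>i. ennreal (D i powr 2))" by simp
    also have "\<dots> \<le> 4 * ennreal e"
      using U(3) unfolding D_def by (intro mult_left_mono) auto
    finally show ?thesis .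
  qed
  have "emeasure lborel ?S \<le> 0"
  proof (rule ennreal_le_epsilon)
    fix e :: real assume "0 < e"
    then show "emeasure lborel ?S \<le> 0 + ennreal e"
      using bound[of "e/4"] by (simp add: ennreal_mult'[symmetric] flip: ennreal_numeral)
  qed
  then show ?thesis using meas by (intro null_setsI) auto
qed

lemma AE_slice_null:
  fixes S :: "(real \<times> real) set"
  assumes "S \<in> null_sets lborel"
  shows "AE \<tau> in lborel. AE r in lborel. (\<tau>, r) \<notin> S"
  using lborel_pair.AE_pair[of "\<lambda>z. z \<notin> S"] AE_not_in[OF assms] unfolding lborel_prod by simp

text \<open>Two distinct points would put an interval of positive measure into
  \<open>I\<close>.\<close>

lemma connected_AE_not_in:
  fixes I :: "real set"
  assumes "connected I" "AE r in lborel. r \<notin> I" "a \<in> I" "b \<in> I"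
  shows "a = b"
proof (rule ccontr)
  assume "a \<noteq> b"
  then have ab: "min a b < max a b" by (auto simp: min_def)
  have "{min a b..max a b} \<subseteq> I" using connected_contains_Icc[OF assms(1)] assms(3,4) by (auto simp: min_def max_def)
  then have "AE r in lborel. r \<notin> {min a b..max a b}" by (intro eventually_mono[OF assms(2)]) blast
  then have "emeasure lborel {min a b..max a b} = 0" 
    by (subst (asm) AE_iff_measurable[of "{min a b..max a b}"]) auto
  then show False using ab by simp
qed

text \<open>A weak substitute for Eilenberg's inequality: each slice is seen through the distance
  functions to a countable dense set, and Fubini applies to the resulting planar null sets.\<close>

lemma AE_level_connected_singleton:
  fixes K :: "'b::metric_space set"
  assumes K: "compact K" and null: "hausdorff_measure 2 K = 0"
  shows "AE \<tau> in lborel. \<forall>Q. connected Q \<longrightarrow> Q \<subseteq> {w \<in> K. dist y0 w = \<tau>} \<longrightarrow> (\<forall>a\<in>Q. \<forall>b\<in>Q. a = b)"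
proof -
  have "\<exists>D. countable D \<and> D \<subseteq> K \<and> (\<forall>x\<in>K. \<forall>e>0. \<exists>y\<in>D. dist x y < e)"
  proof -
    have "\<forall>n. \<exists>k. finite k \<and> k \<subseteq> K \<and> K \<subseteq> (\<Union>x\<in>k. ball x (1 / real (Suc n)))"
      using seq_compact_imp_totally_bounded[OF K[unfolded compact_eq_seq_compact_metric]] by simp
    then obtain k where k: "\<And>n. finite (k n)" "\<And>n. k n \<subseteq> K" "\<And>n. K \<subseteq> (\<Union>x\<in>k n. ball x (1 / real (Suc n)))"
      by metis
    show ?thesis
    proof (intro exI[of _ "\<Union>(range k)"] conjI ballI allI impI)
      show "countable (\<Union>(range k))" using k(1) by (simp add: countable_finite)
      show "\<Union>(range k) \<subseteq> K" using k(2) by auto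
      fix x and e :: real assume "x \<in> K" "0 < e"
      then obtain n where n: "1 / real (Suc n) < e" using nat_approx_posE by metis
      obtain y where "y \<in> k n" "dist y x < 1 / real (Suc n)" using k(3)[of n] \<open>x \<in> K\<close> by auto
      then show "\<exists>y\<in>\<Union>(range k). dist x y < e" using n by (auto simp: dist_commute intro!: bexI[of _ y])
    qed
  qed
  then obtain D where D: "countable D" "\<And>x e. x \<in> K \<Longrightarrow> 0 < e \<Longrightarrow> \<exists>y\<in>D. dist x y < e" by blast
  \<comment> \<open>Countability of \<open>D\<close> allows one exceptional null set of levels for
    all \<open>y \<in> D\<close>.\<close>
  have "AE \<tau> in lborel. \<forall>y\<in>D. AE r in lborel. (\<tau>, r) \<notin> (\<lambda>w. (dist y0 w, dist y w)) ` K"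
  proof (subst AE_ball_countable[OF D(1)], intro ballI AE_slice_null hausdorff_null_imp_planar_null[OF null])
    fix y
    have "compact ((\<lambda>w. (dist y0 w, dist y w)) ` K)"
      by (intro compact_continuous_image K continuous_intros)
    then show "(\<lambda>w. (dist y0 w, dist y w)) ` K \<in> sets borel"
      by (simp add: borel_closed compact_imp_closed)
  qed (metis abs_dist_diff_le dist_commute)+
  then show ?thesis
  proof (rule eventually_mono, intro allI impI ballI)
    fix \<tau> Q a b
    assume \<tau>: "\<forall>y\<in>D. AE r in lborel. (\<tau>, r) \<notin> (\<lambda>w. (dist y0 w, dist y w)) ` K"
      and Q: "connected Q" "Q \<subseteq> {w \<in> K. dist y0 w = \<tau>}" and ab: "a \<in> Q" "b \<in> Q"
    \<comment> \<open>The values of \<open>dist y\<close> on \<open>Q\<close> form a connected null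
      set of reals, hence a single point. Equal distances to a dense set then identify
      \<open>a\<close> and \<open>b\<close>.\<close>
    have eq: "dist y a = dist y b" if "y \<in> D" for y
    proof (rule connected_AE_not_in)
      show "connected (dist y ` Q)" using Q(1) by (intro connected_continuous_image continuous_intros)
      show "AE r in lborel. r \<notin> dist y ` Q" using \<tau>[rule_format, OF that]
        by (rule eventually_mono) (use Q(2) in auto)
    qed (use ab in auto)
    have "dist a b \<le> 0"
    proof (rule field_le_epsilon)
      fix e :: real assume "0 < e"
      then obtain y where y: "y \<in> D" "dist a y < e/2" using D(2)[of a "e/2"] Q(2) ab by auto
      then show "dist a b \<le> 0 + e"
        using eq[OF y(1)] dist_triangle[of a b y] by (simp add: dist_commute)
    qed
    then show "a = b" by simp
  qed
qed

section \<open>Joining by Lipschitz paths, loops and separation in the plane\<close>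

text \<open>The case \<open>t < s\<close> is included, so this also reverses paths.\<close>

lemma lipschitz_on_unit_subpath:
  fixes \<gamma> :: "real \<Rightarrow> 'a::metric_space"
  assumes L: "lipschitz_on L {0..1} \<gamma>" and st: "s \<in> {0..1}" "t \<in> {0..1}"
  shows "lipschitz_on (L * \<bar>t - s\<bar>) {0..1} (\<lambda>u. \<gamma> (s + u * (t - s)))"
proof (rule lipschitz_onI)
  show "0 \<le> L * \<bar>t - s\<bar>" using lipschitz_on_nonneg[OF L] by simp
  have mem: "s + u * (t - s) \<in> {0..1}" if "u \<in> {0..1}" for u
  proof -
    have "s + u * (t - s) = (1 - u) * s + u * t" by (simp add: algebra_simps)
    then show ?thesis
      using convexD[OF convex_real_interval(5)[of 0 1] st, of "1 - u" u] that by simp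
  qed
  fix u v :: real assume uv: "u \<in> {0..1}" "v \<in> {0..1}"
  have "dist (s + u * (t - s)) (s + v * (t - s)) = \<bar>t - s\<bar> * dist u v"
    by (simp add: dist_real_def abs_mult[symmetric] algebra_simps)
  then show "dist (\<gamma> (s + u * (t - s))) (\<gamma> (s + v * (t - s))) \<le> L * \<bar>t - s\<bar> * dist u v"
    using lipschitz_onD[OF L mem[OF uv(1)] mem[OF uv(2)]] by (simp add: mult.assoc)
qed

text \<open>The constant is left open: it only has to make the resulting loops Lipschitz, so that
  they can be filled. Costs are recorded by \<open>reach\<close> instead.\<close>

definition lip_joined :: "'a::metric_space set \<Rightarrow> 'a \<Rightarrow> 'a \<Rightarrow> bool" where
  "lip_joined S x y \<longleftrightarrow>
     (\<exists>L \<gamma>. lipschitz_on L {0..1::real} \<gamma> \<and> \<gamma> 0 = x \<and> \<gamma> 1 = y \<and> \<gamma> ` {0..1} \<subseteq> S)"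

lemma lip_joined_mono: "lip_joined S x y \<Longrightarrow> S \<subseteq> T \<Longrightarrow> lip_joined T x y"
  unfolding lip_joined_def by blast

lemma lip_joined_in: "lip_joined S x y \<Longrightarrow> x \<in> S \<and> y \<in> S"
  unfolding lip_joined_def by force

lemma lip_joined_refl: "x \<in> S \<Longrightarrow> lip_joined S x x"
  unfolding lip_joined_def
  by (intro exI[of _ 0] exI[of _ "\<lambda>_. x"]) (auto intro: lipschitz_on_constant)

lemma lip_joined_sym: "lip_joined S x y \<Longrightarrow> lip_joined S y x"
proof -
  assume "lip_joined S x y"
  then obtain L \<gamma> where \<gamma>: "lipschitz_on L {0..1::real} \<gamma>" "\<gamma> 0 = x" "\<gamma> 1 = y" "\<gamma> ` {0..1} \<subseteq> S"
    unfolding lip_joined_def by blast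
  have "lipschitz_on (L * \<bar>0 - 1\<bar>) {0..1} (\<lambda>u. \<gamma> (1 + u * (0 - 1)))"
    by (rule lipschitz_on_unit_subpath[OF \<gamma>(1)]) auto
  moreover have "(\<lambda>u. \<gamma> (1 + u * (0 - 1))) ` {0..1} \<subseteq> S" using \<gamma>(4) by auto
  ultimately show ?thesis unfolding lip_joined_def using \<gamma>(2,3)
    by (intro exI[of _ "L * \<bar>0 - 1\<bar>"] exI[of _ "\<lambda>u. \<gamma> (1 + u * (0 - 1))"]) auto
qed

lemma lip_joined_trans:
  assumes "lip_joined S x y" "lip_joined S y z"
  shows "lip_joined S x z"
proof -
  obtain L \<gamma> where \<gamma>: "lipschitz_on L {0..1::real} \<gamma>" "\<gamma> 0 = x" "\<gamma> 1 = y" "\<gamma> ` {0..1} \<subseteq> S"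
    using assms(1) unfolding lip_joined_def by blast
  obtain M \<delta> where \<delta>: "lipschitz_on M {0..1::real} \<delta>" "\<delta> 0 = y" "\<delta> 1 = z" "\<delta> ` {0..1} \<subseteq> S"
    using assms(2) unfolding lip_joined_def by blast
  let ?c = "\<lambda>t. if t \<le> 1/2 then \<gamma> (2 * t) else \<delta> (2 * t - 1)"
  have "lipschitz_on (L * 2) {0..1/2} (\<lambda>t. \<gamma> (2 * t))"
  proof (rule lipschitz_onI)
    fix s t :: real assume "s \<in> {0..1/2}" "t \<in> {0..1/2}"
    then have "dist (\<gamma> (2 * s)) (\<gamma> (2 * t)) \<le> L * dist (2 * s) (2 * t)"
      by (intro lipschitz_onD[OF \<gamma>(1)]) auto
    also have "dist (2 * s) (2 * t) = 2 * dist s t"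
      by (simp add: dist_real_def abs_if)
    finally show "dist (\<gamma> (2 * s)) (\<gamma> (2 * t)) \<le> L * 2 * dist s t" by simp
  qed (use lipschitz_on_nonneg[OF \<gamma>(1)] in simp)
  moreover have "lipschitz_on (M * 2) {1/2..1} (\<lambda>t. \<delta> (2 * t - 1))"
  proof (rule lipschitz_onI)
    fix s t :: real assume "s \<in> {1/2..1}" "t \<in> {1/2..1}"
    then have "dist (\<delta> (2 * s - 1)) (\<delta> (2 * t - 1)) \<le> M * dist (2 * s - 1) (2 * t - 1)"
      by (intro lipschitz_onD[OF \<delta>(1)]) auto
    also have "dist (2 * s - 1) (2 * t - 1) = 2 * dist s t"
      by (simp add: dist_real_def abs_if)
    finally show "dist (\<delta> (2 * s - 1)) (\<delta> (2 * t - 1)) \<le> M * 2 * dist s t" by simp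
  qed (use lipschitz_on_nonneg[OF \<delta>(1)] in simp)
  ultimately have "lipschitz_on (max (L * 2) (M * 2)) {0..1} ?c"
    by (rule lipschitz_on_concat_max) (use \<gamma> \<delta> in auto)
  moreover have "?c ` {0..1} \<subseteq> S" using \<gamma>(4) \<delta>(4) by (auto simp: image_subset_iff)
  ultimately show ?thesis unfolding lip_joined_def using \<gamma>(2) \<delta>(3)
    by (intro exI[of _ "max (L * 2) (M * 2)"] exI[of _ ?c]) auto
qed

text \<open>The last estimate bounds the horizontal distance to the nearer of \<open>1\<close> and
  \<open>-1\<close> by the distance to the real axis, which is what compares points on opposite half
  circles.\<close>

lemma circle_coords:
  assumes "z \<in> sphere (0::complex) 1"
  shows "(Re z)\<^sup>2 + (Im z)\<^sup>2 = 1" "\<bar>Re z\<bar> \<le> 1" "1 - \<bar>Re z\<bar> \<le> \<bar>Im z\<bar>"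
proof -
  have n: "cmod z = 1" using assms by simp
  then show eq: "(Re z)\<^sup>2 + (Im z)\<^sup>2 = 1" by (metis cmod_power2 one_power2)
  show le: "\<bar>Re z\<bar> \<le> 1" using abs_Re_le_cmod[of z] n by simp
  have "(1 - \<bar>Re z\<bar>) * (1 - \<bar>Re z\<bar>) \<le> (1 - \<bar>Re z\<bar>) * (1 + \<bar>Re z\<bar>)"
    using le by (intro mult_left_mono) auto
  also have "\<dots> = 1 - \<bar>Re z\<bar>\<^sup>2" by (simp add: algebra_simps power2_eq_square)
  also have "\<dots> = \<bar>Im z\<bar>\<^sup>2" using eq by simp
  finally have "(1 - \<bar>Re z\<bar>)\<^sup>2 \<le> \<bar>Im z\<bar>\<^sup>2" by (simp only: power2_eq_square)
  then show "1 - \<bar>Re z\<bar> \<le> \<bar>Im z\<bar>" by (rule power2_le_imp_le) simp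
qed

text \<open>The real part is a Lipschitz coordinate on each half circle; points on different halves are
  compared through one of the common end points \<open>1\<close> and \<open>-1\<close>.\<close>

lemma lipschitz_loop_from_paths:
  fixes \<alpha> \<beta> :: "real \<Rightarrow> 'a::metric_space"
  assumes \<alpha>: "lipschitz_on L {0..1} \<alpha>" and \<beta>: "lipschitz_on L {0..1} \<beta>"
    and ends: "\<alpha> 0 = \<beta> 0" "\<alpha> 1 = \<beta> 1"
  obtains \<Gamma> :: "complex \<Rightarrow> 'a" where "lipschitz_on (2 * L) (sphere 0 1) \<Gamma>"
    "\<And>z. z \<in> sphere 0 1 \<Longrightarrow> 0 \<le> Im z \<Longrightarrow> \<Gamma> z = \<alpha> ((1 + Re z) / 2)"
    "\<And>z. z \<in> sphere 0 1 \<Longrightarrow> Im z \<le> 0 \<Longrightarrow> \<Gamma> z = \<beta> ((1 + Re z) / 2)"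
proof -
  have L0: "0 \<le> L" using lipschitz_on_nonneg[OF \<alpha>] .
  define \<pi> where "\<pi> z = (1 + Re z) / 2" for z
  define \<Gamma> where "\<Gamma> z = (if 0 \<le> Im z then \<alpha> (\<pi> z) else \<beta> (\<pi> z))" for z
  have \<pi>: "\<pi> z \<in> {0..1}" if "z \<in> sphere 0 1" for z
    using circle_coords(2)[OF that] unfolding \<pi>_def by auto
  have same: "dist (\<gamma> (\<pi> z)) (\<gamma> (\<pi> w)) \<le> 2 * L * dist z w"
    if "lipschitz_on L {0..1} \<gamma>" "z \<in> sphere 0 1" "w \<in> sphere 0 1" for \<gamma> :: "real \<Rightarrow> 'a" and z w
  proof -
    have "dist (\<gamma> (\<pi> z)) (\<gamma> (\<pi> w)) \<le> L * dist (\<pi> z) (\<pi> w)"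
      using lipschitz_onD[OF that(1)] \<pi> that by blast
    also have "dist (\<pi> z) (\<pi> w) \<le> 2 * dist z w"
      using abs_Re_le_cmod[of "z - w"] unfolding \<pi>_def dist_real_def dist_norm
      by (simp add: diff_divide_distrib[symmetric])
    finally show ?thesis using L0 by (simp add: mult_left_mono mult.assoc)
  qed
  have cross: "dist (\<alpha> (\<pi> z)) (\<beta> (\<pi> w)) \<le> 2 * L * dist z w"
    if z: "z \<in> sphere 0 1" "0 \<le> Im z" and w: "w \<in> sphere 0 1" "Im w \<le> 0" for z w
  proof -
    note cz = circle_coords[OF z(1)] and cw = circle_coords[OF w(1)]
    have via1: "dist (\<alpha> (\<pi> z)) (\<beta> (\<pi> w)) \<le> L * ((1 - \<pi> z) + (1 - \<pi> w))"
      using lipschitz_onD[OF \<alpha> \<pi>[OF z(1)], of 1] lipschitz_onD[OF \<beta> \<pi>[OF w(1)], of 1] \<pi>[OF z(1)] \<pi>[OF w(1)]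
        dist_triangle2[of "\<alpha> (\<pi> z)" "\<beta> (\<pi> w)" "\<alpha> 1"] ends
      by (simp add: dist_real_def algebra_simps)
    have via0: "dist (\<alpha> (\<pi> z)) (\<beta> (\<pi> w)) \<le> L * (\<pi> z + \<pi> w)"
      using lipschitz_onD[OF \<alpha> \<pi>[OF z(1)], of 0] lipschitz_onD[OF \<beta> \<pi>[OF w(1)], of 0] \<pi>[OF z(1)] \<pi>[OF w(1)]
        dist_triangle2[of "\<alpha> (\<pi> z)" "\<beta> (\<pi> w)" "\<alpha> 0"] ends
      by (simp add: dist_real_def algebra_simps)
    have Im: "Im z - Im w \<le> dist z w"
      using abs_Im_le_cmod[of "z - w"] by (simp add: dist_norm)
    \<comment> \<open>If the real parts do not have the same strict sign, \<open>z\<close> and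
      \<open>w\<close> are at distance at least 1, while either route has parameter length at most
      2. Otherwise the end point on their side is close, by \<open>circle_coords\<close>.\<close>
    have "(1 - \<pi> z) + (1 - \<pi> w) \<le> 2 * dist z w \<or> \<pi> z + \<pi> w \<le> 2 * dist z w"
    proof (cases "Re z * Re w \<le> 0")
      case True
      have "(dist z w)\<^sup>2 = (Re z - Re w)\<^sup>2 + (Im z - Im w)\<^sup>2"
        by (simp add: dist_norm cmod_power2)
      also have "\<dots> = 2 - 2 * (Re z * Re w) - 2 * (Im z * Im w)"
        using cz(1) cw(1) by (simp add: power2_diff)
      also have "\<dots> \<ge> 1" using True mult_nonneg_nonpos[OF z(2) w(2)] by linarith
      finally have "1 \<le> dist z w" using power2_le_imp_le[of 1 "dist z w"] by simp
      then show ?thesis using \<pi>[OF z(1)] \<pi>[OF w(1)] by auto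
    next
      case False
      then consider "0 \<le> Re z" "0 \<le> Re w" | "Re z \<le> 0" "Re w \<le> 0"
        by (auto simp: mult_le_0_iff)
      then show ?thesis
        by cases (use cz(3) cw(3) Im z w in \<open>auto simp: \<pi>_def field_simps\<close>)
    qed
    then show ?thesis
    proof
      assume "(1 - \<pi> z) + (1 - \<pi> w) \<le> 2 * dist z w"
      from mult_left_mono[OF this L0] show ?thesis using via1 by (simp add: mult.assoc mult.left_commute)
    next
      assume "\<pi> z + \<pi> w \<le> 2 * dist z w"
      from mult_left_mono[OF this L0] show ?thesis using via0 by (simp add: mult.assoc mult.left_commute)
    qed
  qed
  have "lipschitz_on (2 * L) (sphere 0 1) \<Gamma>"
  proof (rule lipschitz_onI)
    fix z w :: complex assume "z \<in> sphere 0 1" "w \<in> sphere 0 1"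
    then show "dist (\<Gamma> z) (\<Gamma> w) \<le> 2 * L * dist z w"
      using same[OF \<alpha>, of z w] same[OF \<beta>, of z w] cross[of z w] cross[of w z]
      by (auto simp: \<Gamma>_def dist_commute)
  qed (use L0 in simp)
  \<comment> \<open>On the real axis \<open>\<Gamma>\<close> uses \<open>\<alpha>\<close>, which
    agrees with \<open>\<beta>\<close> there by \<open>ends\<close>.\<close>
  moreover have "\<Gamma> z = \<beta> (\<pi> z)" if "z \<in> sphere 0 1" "Im z \<le> 0" for z
  proof (cases "Im z = 0")
    case True
    then have "\<pi> z = 0 \<or> \<pi> z = 1" using circle_coords(1)[OF that(1)] unfolding \<pi>_def
      by (auto simp: power2_eq_1_iff)
    then show ?thesis using ends by (auto simp: \<Gamma>_def)
  qed (use that in \<open>simp add: \<Gamma>_def\<close>)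
  ultimately show thesis using that[of \<Gamma>] unfolding \<pi>_def by (simp add: \<Gamma>_def \<pi>_def)
qed

lemma connected_half_circles:
  "connected {z \<in> sphere (0::complex) 1. 0 \<le> Im z}" "connected {z \<in> sphere (0::complex) 1. Im z \<le> 0}"
proof -
  have "{z \<in> sphere (0::complex) 1. 0 \<le> Im z} = (\<lambda>u. Complex u (sqrt (1 - u\<^sup>2))) ` {-1..1}" (is "?U = ?p ` _")
  proof (intro equalityI subsetI)
    fix z assume z: "z \<in> ?U"
    then have "sqrt (1 - (Re z)\<^sup>2) = Im z"
      using circle_coords(1)[of z] by (auto intro!: real_sqrt_unique)
    then show "z \<in> ?p ` {-1..1}" using circle_coords(2)[of z] z
      by (intro image_eqI[of _ _ "Re z"]) (auto simp: complex_eq_iff)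
  next
    fix z assume "z \<in> ?p ` {-1..1}"
    then obtain u where u: "u \<in> {-1..1}" "z = ?p u" by blast
    then have "u\<^sup>2 \<le> 1" by (auto simp: abs_square_le_1)
    then show "z \<in> ?U" using u by (auto simp: cmod_def)
  qed
  also have "connected \<dots>"
    by (intro connected_continuous_image continuous_intros) auto
  finally show U: "connected ?U" .
  have "cnj ` ?U = {z \<in> sphere (0::complex) 1. Im z \<le> 0}"
    by (auto intro!: image_eqI[of _ cnj "cnj _"])
  then show "connected {z \<in> sphere (0::complex) 1. Im z \<le> 0}"
    using connected_continuous_image[OF _ U, of cnj] by (simp add: continuous_on_cnj)
qed

text \<open>The full level set separates \<open>a\<close> from \<open>b\<close> by the intermediate
  value theorem. In Euclidean space a closed set separating two points has a component that does so
  already.\<close>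

lemma separating_level_component:
  fixes k :: "'a::euclidean_space \<Rightarrow> real"
  assumes k: "continuous_on UNIV k" and "k a < \<tau>" "\<tau> < k b"
  obtains Q where "connected Q" "\<And>q. q \<in> Q \<Longrightarrow> k q = \<tau>"
    "\<And>T. connected T \<Longrightarrow> a \<in> T \<Longrightarrow> b \<in> T \<Longrightarrow> T \<inter> Q \<noteq> {}"
proof -
  let ?S = "{z. k z = \<tau>}"
  have "closed ?S" using k by (intro closed_Collect_eq) auto
  moreover have "\<not> connected_component (- ?S) a b"
  proof
    assume "connected_component (- ?S) a b"
    then obtain T where T: "connected T" "T \<subseteq> - ?S" "a \<in> T" "b \<in> T"
      unfolding connected_component_def by blast
    have "connected (k ` T)" using T(1) continuous_on_subset[OF k] by (blast intro: connected_continuous_image)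
    then have "{k a..k b} \<subseteq> k ` T" using connected_contains_Icc T(3,4) by blast
    then have "\<tau> \<in> k ` T" using assms(2,3) by auto
    then show False using T(2) by auto
  qed
  ultimately obtain Q where Q: "Q \<in> components ?S" "\<not> connected_component (- Q) a b"
    by (rule separation_by_component_closed_pointwise)
  show thesis
  proof (rule that[of Q])
    show "connected Q" using Q(1) by (rule in_components_connected)
    show "k q = \<tau>" if "q \<in> Q" for q using in_components_subset[OF Q(1)] that by blast
    show "T \<inter> Q \<noteq> {}" if "connected T" "a \<in> T" "b \<in> T" for T
      using Q(2) that unfolding connected_component_def by blast
  qed
qed

section \<open>The tree pseudo-metric\<close>

locale tree_factorization =
  fixes f :: "'a::metric_space \<Rightarrow> 'b::metric_space" and K C :: real and p :: 'a
  assumes f_lip: "lipschitz_on K UNIV f"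
    and qc: "\<exists>\<gamma> :: real \<Rightarrow> 'a. lipschitz_on (C * dist x y) {0..1::real} \<gamma> \<and> \<gamma> 0 = x \<and> \<gamma> 1 = y"
begin

text \<open>A path is charged \<open>K\<close> times its Lipschitz constant, but travelling inside a connected
  subset of a fibre of \<open>f\<close> is free, even if that set contains no path at all.\<close>

inductive reach :: "real \<Rightarrow> 'a \<Rightarrow> bool" where
  base: "reach 0 p"
| path: "reach r (\<gamma> 0) \<Longrightarrow> lipschitz_on L {0..1::real} \<gamma> \<Longrightarrow> reach (r + K * L) (\<gamma> 1)"
| fibre: "reach r x \<Longrightarrow> connected Q \<Longrightarrow> x \<in> Q \<Longrightarrow> y \<in> Q \<Longrightarrow> (\<And>q. q \<in> Q \<Longrightarrow> f q = f x) \<Longrightarrow> reach r y"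

definition height :: "'a \<Rightarrow> real" where
  "height x = Inf {r. reach r x}"

lemma K_nonneg: "0 \<le> K"
  using lipschitz_on_nonneg[OF f_lip] .

lemma f_dist: "dist (f x) (f y) \<le> K * dist x y"
  using lipschitz_onD[OF f_lip] by simp

lemma C_dist_nonneg: "0 \<le> C * dist x y" for x y :: 'a
  using qc[of x y] lipschitz_on_nonneg by blast

lemma reach_nonneg: "reach r x \<Longrightarrow> 0 \<le> r"
  by (induction rule: reach.induct) (auto simp: K_nonneg dest: lipschitz_on_nonneg)

lemma reach_ex: "\<exists>r. reach r x"
proof -
  obtain \<gamma> where "lipschitz_on (C * dist p x) {0..1::real} \<gamma>" "\<gamma> 0 = p" "\<gamma> 1 = x"
    using qc[of p x] by blast
  then show ?thesis using reach.path[of 0 \<gamma>] reach.base by auto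
qed

lemma height_le: "reach r x \<Longrightarrow> height x \<le> r"
  unfolding height_def by (intro cInf_lower bdd_belowI[of _ 0]) (auto intro: reach_nonneg)

lemma height_greatest: "(\<And>r. reach r x \<Longrightarrow> c \<le> r) \<Longrightarrow> c \<le> height x"
  unfolding height_def using reach_ex by (intro cInf_greatest) auto

lemma height_nonneg: "0 \<le> height x"
  by (rule height_greatest) (rule reach_nonneg)

lemma height_base: "height p = 0"
  using height_le[OF reach.base] height_nonneg[of p] by simp

lemma height_approx:
  assumes "0 < e" obtains r where "reach r x" "r < height x + e"
proof -
  have "\<exists>r. reach r x \<and> r < height x + e"
    using height_greatest[of x "height x + e"] assms by (meson add_less_same_cancel1 not_le not_less_iff_gr_or_eq less_add_same_cancel1)
  then show thesis using that by blast
qed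

lemma height_path:
  assumes "lipschitz_on L {0..1::real} \<gamma>"
  shows "height (\<gamma> 1) \<le> height (\<gamma> 0) + K * L"
proof -
  have "height (\<gamma> 1) - K * L \<le> height (\<gamma> 0)"
  proof (rule height_greatest)
    fix r assume "reach r (\<gamma> 0)"
    from height_le[OF reach.path[OF this assms]] show "height (\<gamma> 1) - K * L \<le> r" by simp
  qed
  then show ?thesis by simp
qed

lemma reach_subpath:
  assumes "lipschitz_on L {0..1::real} \<gamma>" "s \<in> {0..1}" "t \<in> {0..1}" "reach r (\<gamma> s)"
  shows "reach (r + K * (L * \<bar>t - s\<bar>)) (\<gamma> t)"
  using reach.path[OF _ lipschitz_on_unit_subpath[OF assms(1-3)], of r] assms(4) by simp

lemma height_subpath:
  assumes "lipschitz_on L {0..1::real} \<gamma>" "s \<in> {0..1}" "t \<in> {0..1}"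
  shows "height (\<gamma> t) \<le> height (\<gamma> s) + K * (L * \<bar>t - s\<bar>)"
  using height_path[OF lipschitz_on_unit_subpath[OF assms]] by simp

lemma height_diff: "height y \<le> height x + K * (C * dist x y)"
  using qc[of x y] height_path by metis

lemma height_lipschitz: "lipschitz_on (K * \<bar>C\<bar>) UNIV height"
proof (rule lipschitz_onI)
  fix x y :: 'a
  have "K * (C * dist x y) \<le> K * \<bar>C\<bar> * dist x y"
    using K_nonneg by (simp add: mult.assoc mult_left_mono mult_right_mono)
  then show "dist (height x) (height y) \<le> K * \<bar>C\<bar> * dist x y"
    using height_diff[of x y] height_diff[of y x] by (simp add: dist_real_def dist_commute)
qed (simp add: K_nonneg)

text \<open>This is the purpose of the rule \<open>fibre\<close>: points of \<open>Q\<close> are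
  reached at exactly the same costs.\<close>

lemma height_fibre:
  assumes "connected Q" "\<And>x y. x \<in> Q \<Longrightarrow> y \<in> Q \<Longrightarrow> f x = f y" "x \<in> Q" "y \<in> Q"
  shows "height x = height y"
proof -
  have "height y \<le> height x" if "x \<in> Q" "y \<in> Q" for x y
    by (rule height_greatest) (blast intro: height_le reach.fibre[OF _ assms(1)] assms(2) that)
  then show ?thesis using assms(3,4) by (meson antisym)
qed

lemma lip_joined_UNIV: "lip_joined UNIV x y" for x y :: 'a
  using qc[of x y] unfolding lip_joined_def by blast

text \<open>Nearby points of \<open>Q\<close> are joined by short paths that stay close to
  \<open>Q\<close>; connectedness chains these together.\<close>

lemma lip_joined_near_connected:
  fixes Q :: "'a set"
  assumes "connected Q" "x \<in> Q" "y \<in> Q" "0 < e"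
  shows "lip_joined {a. \<exists>q\<in>Q. dist a q \<le> e} x y"
proof (rule connected_equivalence_relation[OF assms(1-3)])
  fix a assume a: "a \<in> Q"
  \<comment> \<open>A path with constant \<open>C * dist a b\<close> stays within \<open>e\<close>
    of \<open>a\<close> for \<open>b\<close> in this ball; adding 1 keeps the denominator
    positive.\<close>
  define T where "T = Q \<inter> ball a (e / (\<bar>C\<bar> + 1))"
  have "lip_joined {a. \<exists>q\<in>Q. dist a q \<le> e} a b" if "b \<in> T" for b
  proof -
    obtain \<gamma> where \<gamma>: "lipschitz_on (C * dist a b) {0..1::real} \<gamma>" "\<gamma> 0 = a" "\<gamma> 1 = b"
      using qc[of a b] by blast
    have "dist (\<gamma> t) a \<le> e" if t: "t \<in> {0..1}" for t
    proof -
      have "dist (\<gamma> t) (\<gamma> 0) \<le> C * dist a b * dist t 0"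
        using t by (intro lipschitz_onD[OF \<gamma>(1)]) auto
      also have "\<dots> \<le> C * dist a b * 1"
        using t by (intro mult_left_mono C_dist_nonneg) auto
      also have "\<dots> \<le> (\<bar>C\<bar> + 1) * dist a b" by (simp add: mult_right_mono)
      also have "\<dots> \<le> e"
        using \<open>b \<in> T\<close> unfolding T_def by (auto simp: pos_less_divide_eq mult.commute)
      finally show ?thesis using \<gamma>(2) by simp
    qed
    then have "\<gamma> ` {0..1} \<subseteq> {a. \<exists>q\<in>Q. dist a q \<le> e}" using a by blast
    then show ?thesis using \<gamma> unfolding lip_joined_def by blast
  qed
  moreover have "openin (top_of_set Q) T" unfolding T_def by (intro openin_open_Int) auto
  moreover have "a \<in> T" using a assms(4) unfolding T_def by simp
  ultimately show "\<exists>T. openin (top_of_set Q) T \<and> a \<in> T \<and> (\<forall>b\<in>T. lip_joined {a. \<exists>q\<in>Q. dist a q \<le> e} a b)"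
    by blast
qed (blast intro: lip_joined_sym lip_joined_trans)+

text \<open>At each point of the way, the cost already spent bounds the height and the cost still to
  come bounds the distance to \<open>f x\<close>. The slack \<open>e\<close> pays for replacing
  fibre pieces by nearby paths.\<close>

lemma reach_joined:
  assumes "reach r x" "0 < e"
  shows "lip_joined {a. dist (f a) (f x) + height a \<le> r + e} p x"
  using assms(1)
proof (induction rule: reach.induct)
  case base
  show ?case using assms(2) by (intro lip_joined_refl) (simp add: height_base)
next
  case (path r \<gamma> L)
  have fd: "dist (f (\<gamma> t)) (f (\<gamma> 1)) \<le> K * (L * (1 - t))" if "t \<in> {0..1}" for t
    using order_trans[OF f_dist mult_left_mono[OF lipschitz_onD[OF path.hyps(2) that, of 1] K_nonneg]] that
    by (simp add: dist_real_def)
  have "lip_joined {a. dist (f a) (f (\<gamma> 1)) + height a \<le> r + K * L + e} p (\<gamma> 0)"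
  proof (rule lip_joined_mono[OF path.IH], clarify)
    fix a assume "dist (f a) (f (\<gamma> 0)) + height a \<le> r + e"
    then show "dist (f a) (f (\<gamma> 1)) + height a \<le> r + K * L + e"
      using fd[of 0] dist_triangle[of "f a" "f (\<gamma> 1)" "f (\<gamma> 0)"] by simp
  qed
  moreover have "lip_joined {a. dist (f a) (f (\<gamma> 1)) + height a \<le> r + K * L + e} (\<gamma> 0) (\<gamma> 1)"
    unfolding lip_joined_def
  proof (intro exI conjI)
    show "lipschitz_on L {0..1} \<gamma>" by (rule path.hyps(2))
    show "\<gamma> ` {0..1} \<subseteq> {a. dist (f a) (f (\<gamma> 1)) + height a \<le> r + K * L + e}"
    proof clarify
      fix t :: real assume t: "t \<in> {0..1}"
      have "height (\<gamma> t) \<le> r + K * (L * t)"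
        using height_le[OF reach_subpath[OF path.hyps(2) _ t path.hyps(1)]] t by simp
      then show "dist (f (\<gamma> t)) (f (\<gamma> 1)) + height (\<gamma> t) \<le> r + K * L + e"
        using fd[OF t] assms(2) by (simp add: algebra_simps)
    qed
  qed auto
  ultimately show ?case by (rule lip_joined_trans)
next
  case (fibre r x Q y)
  \<comment> \<open>Within \<open>\<eta>\<close> of \<open>Q\<close>, \<open>f\<close> changes by at
    most \<open>K * \<eta>\<close> and the height by at most
    \<open>K * \<bar>C\<bar> * \<eta>\<close>, together at most \<open>e\<close>.\<close>
  define \<eta> where "\<eta> = e / (K + K * \<bar>C\<bar> + 1)"
  have pos: "0 < K + K * \<bar>C\<bar> + 1" using K_nonneg by (simp add: add_nonneg_pos)
  then have \<eta>: "0 < \<eta>" "(K + K * \<bar>C\<bar> + 1) * \<eta> = e" using assms(2) by (auto simp: \<eta>_def)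
  have fy: "f y = f x" using fibre.hyps by blast
  have "lip_joined {a. dist (f a) (f x) + height a \<le> r + e} x y"
  proof (rule lip_joined_mono[OF lip_joined_near_connected[OF fibre.hyps(2-4) \<eta>(1)]], clarify)
    fix a q assume q: "q \<in> Q" "dist a q \<le> \<eta>"
    have "dist (f a) (f x) \<le> K * \<eta>"
      using order_trans[OF f_dist mult_left_mono[OF q(2) K_nonneg]] fibre.hyps(5)[OF q(1)] by simp
    moreover have "dist (height a) (height q) \<le> K * \<bar>C\<bar> * \<eta>"
      using order_trans[OF lipschitz_onD[OF height_lipschitz] mult_left_mono[OF q(2)]] K_nonneg by simp
    moreover have "height q \<le> r"
      using fibre q(1) by (blast intro: height_le reach.fibre)
    ultimately show "dist (f a) (f x) + height a \<le> r + e"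
      using \<eta> by (simp add: dist_real_def algebra_simps)
  qed
  then show ?case unfolding fy using fibre.IH by (rule lip_joined_trans[rotated])
qed

lemma height_joined:
  assumes "0 < e"
  shows "lip_joined {a. dist (f a) (f x) + height a \<le> height x + e} p x"
proof -
  obtain r where r: "reach r x" "r < height x + e/2" using height_approx[of "e/2"] assms by auto
  show ?thesis
    by (rule lip_joined_mono[OF reach_joined[OF r(1), of "e/2"]]) (use r assms in auto)
qed

text \<open>The starting point \<open>p\<close> of the path in \<open>height_joined\<close> lies in
  the set there and has height 0.\<close>

lemma f_dist_base: "dist (f p) (f x) \<le> height x"
proof (rule field_le_epsilon)
  fix e :: real assume "0 < e"
  from lip_joined_in[OF height_joined[OF this, of x]] show "dist (f p) (f x) \<le> height x + e"
    by (simp add: height_base)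
qed

text \<open>In the tree to be built this is the Gromov product of \<open>x\<close> and
  \<open>y\<close> at the base point: the height at which the ways to them branch.\<close>

definition meet :: "'a \<Rightarrow> 'a \<Rightarrow> real" where
  "meet x y = Sup {s. lip_joined {a. s \<le> height a} x y}"

definition tdist :: "'a \<Rightarrow> 'a \<Rightarrow> real" where
  "tdist x y = height x + height y - 2 * meet x y"

lemma meet_upper: "lip_joined {a. s \<le> height a} x y \<Longrightarrow> s \<le> meet x y"
  unfolding meet_def
  by (intro cSup_upper bdd_aboveI[of _ "height x"]) (auto dest: lip_joined_in)

lemma meet_least: "(\<And>s. lip_joined {a. s \<le> height a} x y \<Longrightarrow> s \<le> c) \<Longrightarrow> meet x y \<le> c"
proof -
  have "lip_joined {a. 0 \<le> height a} x y"
    using lip_joined_UNIV by (simp add: height_nonneg)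
  then show "(\<And>s. lip_joined {a. s \<le> height a} x y \<Longrightarrow> s \<le> c) \<Longrightarrow> meet x y \<le> c"
    unfolding meet_def by (intro cSup_least) auto
qed

lemma meet_joined:
  assumes "s < meet x y" shows "lip_joined {a. s \<le> height a} x y"
proof (rule ccontr)
  assume no: "\<not> lip_joined {a. s \<le> height a} x y"
  have "meet x y \<le> s"
  proof (rule meet_least)
    fix t assume "lip_joined {a. t \<le> height a} x y"
    then show "t \<le> s" using no lip_joined_mono[of "{a. t \<le> height a}" x y "{a. s \<le> height a}"] by fastforce
  qed
  then show False using assms by simp
qed

lemma meet_commute: "meet x y = meet y x"
  unfolding meet_def using lip_joined_sym by metis

lemma meet_le: "meet x y \<le> height x"
  by (rule meet_least) (auto dest: lip_joined_in)

lemma meet_refl: "meet x x = height x"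
  by (intro antisym meet_le meet_upper lip_joined_refl) simp

text \<open>Paths above a common level can be concatenated.\<close>

lemma meet_ultra: "min (meet x y) (meet y z) \<le> meet x z"
proof (rule dense_le)
  fix s assume "s < min (meet x y) (meet y z)"
  then show "s \<le> meet x z"
    by (intro meet_upper lip_joined_trans[of _ x y z] meet_joined) auto
qed

lemma tdist_refl: "tdist x x = 0"
  by (simp add: tdist_def meet_refl)

lemma tdist_commute: "tdist x y = tdist y x"
  by (simp add: tdist_def meet_commute)

lemma tdist_nonneg: "0 \<le> tdist x y"
  using meet_le[of x y] meet_le[of y x] by (simp add: tdist_def meet_commute)

lemma tdist_triangle: "tdist x z \<le> tdist x y + tdist y z"
  using meet_ultra[of x y z] meet_le[of y x] meet_le[of y z] meet_commute[of x y]
  by (auto simp: tdist_def min_def split: if_splits)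

lemma tdist_four_point: "tdist x y + tdist z w \<le> max (tdist x z + tdist y w) (tdist x w + tdist y z)"
proof -
  note u = meet_ultra[unfolded min_le_iff_disj]
  \<comment> \<open>The heights cancel from the four-point inequality; what remains follows from the
    ultrametric inequalities.\<close>
  have "min (meet x z + meet y w) (meet x w + meet y z) \<le> meet x y + meet z w"
    using u[of x z y] u[of x w y] u[of z x w] u[of z y w] u[of x y z] u[of x y w] u[of y x z] u[of y x w]
      u[of x z w] u[of x w z] u[of y z w] u[of y w z]
    unfolding meet_commute[of z x] meet_commute[of z y] meet_commute[of w x] meet_commute[of w y]
      meet_commute[of w z] meet_commute[of y x] by (smt (verit))
  then show ?thesis unfolding tdist_def by linarith
qed

text \<open>At time \<open>t\<close> of a quasi-convex path the height is at least
  \<open>height x - K * L * t\<close> and at least \<open>height y - K * L * (1 - t)\<close>; the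
  average of the two bounds is a level independent of \<open>t\<close>.\<close>

lemma tdist_le: "tdist x y \<le> K * (C * dist x y)"
proof -
  obtain \<gamma> where \<gamma>: "lipschitz_on (C * dist x y) {0..1::real} \<gamma>" "\<gamma> 0 = x" "\<gamma> 1 = y"
    using qc[of x y] by blast
  define L where "L = C * dist x y"
  have "lip_joined {a. (height x + height y - K * L) / 2 \<le> height a} x y"
    unfolding lip_joined_def
  proof (intro exI conjI)
    show "lipschitz_on L {0..1} \<gamma>" "\<gamma> 0 = x" "\<gamma> 1 = y" using \<gamma> unfolding L_def by auto
    show "\<gamma> ` {0..1} \<subseteq> {a. (height x + height y - K * L) / 2 \<le> height a}"
    proof clarify
      fix t :: real assume t: "t \<in> {0..1}"
      have "height x \<le> height (\<gamma> t) + K * (L * t)" "height y \<le> height (\<gamma> t) + K * (L * (1 - t))"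
        using height_subpath[OF \<gamma>(1) t, of 0] height_subpath[OF \<gamma>(1) t, of 1] t \<gamma>(2,3) unfolding L_def by auto
      then show "(height x + height y - K * L) / 2 \<le> height (\<gamma> t)" by (simp add: algebra_simps)
    qed
  qed
  from meet_upper[OF this] show ?thesis unfolding tdist_def L_def by simp
qed

lemma continuous_tdist: "continuous_on UNIV (tdist x)"
proof -
  have "lipschitz_on (K * \<bar>C\<bar>) UNIV (tdist x)"
  proof (rule lipschitz_onI)
    fix y z
    have "\<bar>tdist x y - tdist x z\<bar> \<le> tdist y z"
      using tdist_triangle[of x y z] tdist_triangle[of x z y] by (simp add: tdist_commute abs_le_iff)
    also have "\<dots> \<le> K * (C * dist y z)" by (rule tdist_le)
    also have "\<dots> \<le> K * \<bar>C\<bar> * dist y z"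
      using K_nonneg by (simp add: mult.assoc mult_left_mono mult_right_mono)
    finally show "dist (tdist x y) (tdist x z) \<le> K * \<bar>C\<bar> * dist y z" by (simp add: dist_real_def)
  qed (simp add: K_nonneg)
  then show ?thesis by (rule lipschitz_on_continuous_on)
qed

lemma connected_space: "connected (UNIV :: 'a set)"
proof (rule path_connected_imp_connected, unfold path_connected_def, intro ballI)
  fix x y :: 'a
  obtain \<gamma> where "lipschitz_on (C * dist x y) {0..1::real} \<gamma>" "\<gamma> 0 = x" "\<gamma> 1 = y"
    using qc[of x y] by blast
  then show "\<exists>g. path g \<and> path_image g \<subseteq> UNIV \<and> pathstart g = x \<and> pathfinish g = y"
    by (intro exI[of _ \<gamma>]) (auto simp: path_def pathstart_def pathfinish_def intro: lipschitz_on_continuous_on)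
qed

text \<open>Otherwise the points whose projection to the way from \<open>x\<close> to \<open>y\<close> lies before, respectively
  after, \<open>s\<close> would disconnect the space.\<close>

lemma tdist_between:
  assumes s: "0 \<le> s" "s \<le> tdist x y"
  shows "\<exists>z. tdist x z = s \<and> tdist z y = tdist x y - s"
proof (rule ccontr)
  assume no: "\<not> ?thesis"
  \<comment> \<open>\<open>G z\<close> is twice the Gromov product of \<open>z\<close> and
    \<open>y\<close> at \<open>x\<close>, hence twice the position of the projection of
    \<open>z\<close>.\<close>
  define G where "G z = tdist x z + tdist x y - tdist z y" for z
  have contG: "continuous_on UNIV G" unfolding G_def
    by (subst (2) tdist_commute) (intro continuous_intros continuous_tdist)
  have "0 < s" using no s tdist_refl[of x] by (metis diff_zero le_less)
  have "open {z. G z < 2 * s}" using contG by (intro open_Collect_less) auto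
  moreover have "open {z. 2 * s \<le> G z}"
  proof (subst open_subopen, clarify)
    fix z assume z: "2 * s \<le> G z"
    \<comment> \<open>This is positive, since \<open>tdist x z = s\<close> would make
      \<open>z\<close> the missing point. By the four-point condition, a move by less than
      \<open>e\<close> cannot bring the projection back before \<open>s\<close>.\<close>
    define e where "e = tdist x z - s"
    have tri: "tdist x y \<le> tdist x z + tdist z y" "tdist x z \<le> tdist x y + tdist z y"
      using tdist_triangle[of x y z] tdist_triangle[of x z y] tdist_commute[of y z] by auto
    have "tdist x z \<noteq> s"
      using no z tri(1) unfolding G_def by force
    then have e: "0 < e" using z tri unfolding G_def e_def by linarith
    have "2 * s \<le> G w" if w: "tdist z w < e" for w
    proof -
      have "tdist x z \<le> tdist x w + tdist z w" using tdist_triangle[of x z w] tdist_commute[of w z] by simp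
      moreover have "tdist x z + tdist w y \<le> max (tdist x w + tdist z y) (tdist x y + tdist z w)"
        using tdist_four_point[of x z w y] tdist_commute[of z y] by simp
      ultimately show ?thesis using z w unfolding G_def e_def by linarith
    qed
    moreover have "open {w. tdist z w < e}" using continuous_tdist by (intro open_Collect_less) auto
    ultimately show "\<exists>T. open T \<and> z \<in> T \<and> T \<subseteq> {z. 2 * s \<le> G z}"
      using e tdist_refl[of z] by (intro exI[of _ "{w. tdist z w < e}"]) auto
  qed
  moreover have "x \<in> {z. G z < 2 * s}" "y \<in> {z. 2 * s \<le> G z}"
    using \<open>0 < s\<close> s by (auto simp: G_def tdist_refl)
  ultimately show False
    using connectedD[OF connected_space, of "{z. G z < 2 * s}" "{z. 2 * s \<le> G z}"] by fastforce
qed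

end

section \<open>Comparison with the target metric\<close>

locale disc_filling = tree_factorization f K C p
  for f :: "'a::metric_space \<Rightarrow> 'b::metric_space" and K C :: real and p :: 'a +
  assumes fill: "\<And>(\<gamma>::complex \<Rightarrow> 'a) L. lipschitz_on L (sphere 0 1) \<gamma> \<Longrightarrow>
        \<exists>g L'. lipschitz_on L' (cball 0 1) g \<and> (\<forall>z\<in>sphere 0 1. g z = \<gamma> z)"
    and unrectifiable: "purely_2_unrectifiable TYPE('b)"
begin

text \<open>A generic level of \<open>dist (f (G a))\<close> has a component separating \<open>a\<close> from \<open>b\<close>. It lies in a
  fibre of \<open>f \<circ> G\<close>, so the height is constant on it, and it crosses both \<open>P\<close> and \<open>P'\<close>.\<close>

lemma level_crossings_eq:
  fixes G :: "complex \<Rightarrow> 'a"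
  assumes contG: "continuous_on UNIV G" and K: "compact (range (f \<circ> G))"
    and null: "hausdorff_measure 2 (range (f \<circ> G)) = 0"
    and e: "0 < e" "e \<le> dist (f (G a)) (f (G b))"
    and A: "connected A" "a \<in> A" "\<And>z. z \<in> A \<Longrightarrow> dist (f (G a)) (f (G z)) < e/3"
    and B: "connected B" "b \<in> B" "\<And>z. z \<in> B \<Longrightarrow> dist (f (G b)) (f (G z)) < e/3"
    and P: "connected P" "P \<inter> A \<noteq> {}" "P \<inter> B \<noteq> {}" "\<And>z. z \<in> P \<Longrightarrow> height (G z) = t"
    and P': "connected P'" "P' \<inter> A \<noteq> {}" "P' \<inter> B \<noteq> {}" "\<And>z. z \<in> P' \<Longrightarrow> height (G z) = t'"
  shows "t = t'"
proof -
  define k where "k z = dist (f (G a)) (f (G z))" for z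
  have contF: "continuous_on UNIV (\<lambda>z. f (G z))"
    using continuous_on_compose2[OF lipschitz_on_continuous_on[OF f_lip] contG] by simp
  have contk: "continuous_on UNIV k" unfolding k_def by (intro continuous_intros contF)
  \<comment> \<open>The interval has positive measure, so it contains a generic level; its ends keep
    \<open>A\<close> below and \<open>B\<close> above that level.\<close>
  have "\<exists>\<tau>\<in>{e/3<..<2*e/3}. \<forall>Q. connected Q \<longrightarrow> Q \<subseteq> {w \<in> range (f \<circ> G). dist (f (G a)) w = \<tau>} \<longrightarrow> (\<forall>a\<in>Q. \<forall>b\<in>Q. a = b)"
    (is "\<exists>\<tau>\<in>_. ?generic \<tau>")
  proof (rule ccontr)
    assume no: "\<not> ?thesis"
    have "AE \<tau> in lborel. \<tau> \<notin> {e/3<..<2*e/3}"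
      by (rule eventually_mono[OF AE_level_connected_singleton[OF K null, of "f (G a)"]]) (use no in blast)
    then have "emeasure lborel {e/3<..<2*e/3} = 0"
      by (subst (asm) AE_iff_measurable[of "{e/3<..<2*e/3}"]) auto
    then show False using e(1) by simp
  qed
  then obtain \<tau> where \<tau>: "e/3 < \<tau>" "\<tau> < 2*e/3" "?generic \<tau>" by auto
  have kA: "k z < \<tau>" if "z \<in> A" for z using A(3)[OF that] \<tau>(1) unfolding k_def by linarith
  have kB: "\<tau> < k z" if "z \<in> B" for z
    using B(3)[OF that] \<tau>(2) e(2) dist_triangle2[of "f (G a)" "f (G b)" "f (G z)"] unfolding k_def by linarith
  obtain Q where Q: "connected Q" "\<And>q. q \<in> Q \<Longrightarrow> k q = \<tau>"
      "\<And>T. connected T \<Longrightarrow> a \<in> T \<Longrightarrow> b \<in> T \<Longrightarrow> T \<inter> Q \<noteq> {}"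
    using separating_level_component[OF contk kA[OF A(2)] kB[OF B(2)]] by blast
  have "connected ((\<lambda>z. f (G z)) ` Q)"
    by (intro connected_continuous_image Q(1) continuous_on_subset[OF contF]) simp
  moreover have "(\<lambda>z. f (G z)) ` Q \<subseteq> {w \<in> range (f \<circ> G). dist (f (G a)) w = \<tau>}"
    using Q(2) by (auto simp: k_def)
  ultimately have constF: "\<forall>a\<in>(\<lambda>z. f (G z)) ` Q. \<forall>b\<in>(\<lambda>z. f (G z)) ` Q. a = b"
    using \<tau>(3) by blast
  have const: "height (G q) = height (G q')" if "q \<in> Q" "q' \<in> Q" for q q'
  proof (rule height_fibre[of "G ` Q"])
    show "connected (G ` Q)"
      by (intro connected_continuous_image Q(1) continuous_on_subset[OF contG]) simp
  qed (use constF that in auto)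
  \<comment> \<open>The connected set \<open>A \<union> P \<union> B\<close> joins \<open>a\<close>
    to \<open>b\<close> and so meets \<open>Q\<close>; on \<open>A\<close> and \<open>B\<close> the
    value of \<open>k\<close> differs from \<open>\<tau>\<close>.\<close>
  have meets: "\<exists>q\<in>Q. q \<in> P" if P: "connected P" "P \<inter> A \<noteq> {}" "P \<inter> B \<noteq> {}" for P
  proof -
    have "connected (A \<union> P)" using connected_Un[OF A(1) P(1)] P(2) by (simp add: Int_commute)
    then have "connected ((A \<union> P) \<union> B)" using connected_Un[OF _ B(1), of "A \<union> P"] P(3) by blast
    then have "((A \<union> P) \<union> B) \<inter> Q \<noteq> {}" using A(2) B(2) by (intro Q(3)) auto
    then obtain q where q: "q \<in> Q" "q \<in> A \<or> q \<in> P \<or> q \<in> B" by blast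
    then have "q \<in> P" using Q(2)[OF q(1)] kA[of q] kB[of q] by auto
    then show ?thesis using q(1) by blast
  qed
  obtain q q' where "q \<in> Q" "q \<in> P" "q' \<in> Q" "q' \<in> P'"
    using meets[OF P(1-3)] meets[OF P'(1-3)] by blast
  then show "t = t'" using const P(4) P'(4) by metis
qed

lemma f_dist_le_levels:
  assumes xy: "lip_joined {a. s \<le> height a} x y"
  shows "dist (f x) (f y) \<le> height x + height y - 2 * s"
proof (rule ccontr)
  assume contra: "\<not> ?thesis"
  \<comment> \<open>Of the excess \<open>6 * e\<close>, two parts go to the near-optimality of the
    two paths and two to \<open>s - e \<le> t\<close>; more than \<open>e\<close> remains in
    \<open>crossing\<close>.\<close>
  define e where "e = (dist (f x) (f y) - (height x + height y - 2 * s)) / 6"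
  have e: "0 < e" "dist (f x) (f y) = height x + height y - 2 * s + 6 * e"
    using contra unfolding e_def by (auto simp: field_simps)
  have s: "0 < s"
    using f_dist_base[of x] f_dist_base[of y] dist_triangle[of "f x" "f y" "f p"] e by (simp add: dist_commute)
  \<comment> \<open>\<open>A\<close> carries a path from \<open>p\<close> to \<open>x\<close>;
    \<open>B\<close> carries one from \<open>p\<close> to \<open>y\<close> followed by the given one
    back to \<open>x\<close>. Below level \<open>s\<close>, a point of \<open>B\<close> is on the
    near-optimal side.\<close>
  define A where "A = {a. dist (f a) (f x) + height a \<le> height x + e}"
  define B where "B = {a. dist (f a) (f y) + height a \<le> height y + e} \<union> {a. s \<le> height a}"
  have "lip_joined A p x" unfolding A_def by (rule height_joined[OF e(1)])
  moreover have "lip_joined B p x"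
    by (rule lip_joined_trans[OF lip_joined_mono[OF height_joined[OF e(1), of y]]
          lip_joined_sym[OF lip_joined_mono[OF xy]]]) (auto simp: B_def)
  ultimately obtain L \<alpha> M \<beta> where
    \<alpha>: "lipschitz_on L {0..1::real} \<alpha>" "\<alpha> 0 = p" "\<alpha> 1 = x" "\<alpha> ` {0..1} \<subseteq> A" and
    \<beta>: "lipschitz_on M {0..1::real} \<beta>" "\<beta> 0 = p" "\<beta> 1 = x" "\<beta> ` {0..1} \<subseteq> B"
    unfolding lip_joined_def by blast
  have "lipschitz_on (max L M) {0..1} \<alpha>" "lipschitz_on (max L M) {0..1} \<beta>"
    using lipschitz_on_mono[OF \<alpha>(1)] lipschitz_on_mono[OF \<beta>(1)] by auto
  from lipschitz_loop_from_paths[OF this] \<alpha>(2,3) \<beta>(2,3) obtain \<Gamma> :: "complex \<Rightarrow> 'a" where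
    \<Gamma>: "lipschitz_on (2 * max L M) (sphere 0 1) \<Gamma>"
      "\<And>z. z \<in> sphere 0 1 \<Longrightarrow> 0 \<le> Im z \<Longrightarrow> \<Gamma> z = \<alpha> ((1 + Re z) / 2)"
      "\<And>z. z \<in> sphere 0 1 \<Longrightarrow> Im z \<le> 0 \<Longrightarrow> \<Gamma> z = \<beta> ((1 + Re z) / 2)"
    by metis
  from fill[OF \<Gamma>(1)] obtain g L' where
    g: "lipschitz_on L' (cball 0 1) g" "\<And>z. z \<in> sphere 0 1 \<Longrightarrow> g z = \<Gamma> z" by blast
  define D where "D = cball (0::complex) 1"
  have D: "closed D" "convex D" "D \<noteq> {}" "compact D" unfolding D_def by auto
  \<comment> \<open>The nearest-point retraction extends the disc map to the plane, where the
    separation lemma applies, without enlarging the image.\<close>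
  define G where "G = g \<circ> closest_point D"
  have contg: "continuous_on D g" using lipschitz_on_continuous_on[OF g(1)] unfolding D_def .
  have contG: "continuous_on UNIV G" unfolding G_def
    by (intro continuous_on_compose continuous_on_closest_point D continuous_on_subset[OF contg])
      (use closest_point_in_set[OF D(1,3)] in auto)
  have GD: "G z = g z" if "z \<in> D" for z
    using closest_point_self[OF that] by (simp add: G_def)
  have G\<Gamma>: "G z = \<Gamma> z" if "z \<in> sphere 0 1" for z
    using GD[of z] g(2)[OF that] that by (simp add: D_def)
  have range: "range (f \<circ> G) = (f \<circ> g) ` D"
  proof
    show "range (f \<circ> G) \<subseteq> (f \<circ> g) ` D"
      using closest_point_in_set[OF D(1,3)] by (auto simp: G_def)
    show "(f \<circ> g) ` D \<subseteq> range (f \<circ> G)" by (rule image_subsetI) (metis GD comp_apply rangeI)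
  qed
  have lipfg: "lipschitz_on (K * L') D (f \<circ> g)"
    by (rule lipschitz_on_compose) (use g(1) lipschitz_on_subset[OF f_lip] in \<open>auto simp: D_def\<close>)
  have compact: "compact (range (f \<circ> G))" unfolding range
    by (intro compact_continuous_image D lipschitz_on_continuous_on[OF lipfg])
  have null: "hausdorff_measure 2 (range (f \<circ> G)) = 0" unfolding range
    by (rule unrectifiable[unfolded purely_2_unrectifiable_def, rule_format, OF borel_closed[OF D(1)] lipfg])
  have conth: "continuous_on UNIV (\<lambda>z. height (G z))"
    using continuous_on_compose2[OF lipschitz_on_continuous_on[OF height_lipschitz] contG] by simp
  have unit: "(1 + Re z) / 2 \<in> {0..1}" if "z \<in> sphere 0 1" for z
    using circle_coords(2)[OF that] by auto
  have ends: "G (-1) = p" "G 1 = x" using G\<Gamma>[of "-1"] G\<Gamma>[of 1] \<Gamma>(2)[of "-1"] \<Gamma>(2)[of 1] \<alpha> by auto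
  have upper: "G z \<in> A" if "z \<in> sphere 0 1" "0 \<le> Im z" for z
    using G\<Gamma>[OF that(1)] \<Gamma>(2)[OF that] \<alpha>(4) unit[OF that(1)] by auto
  have lower: "G z \<in> B" if "z \<in> sphere 0 1" "Im z \<le> 0" for z
    using G\<Gamma>[OF that(1)] \<Gamma>(3)[OF that] \<beta>(4) unit[OF that(1)] by auto
  have "s \<le> height x" using lip_joined_in[OF xy] by simp
  have crossing: "\<exists>P a b. connected P \<and> (\<forall>z\<in>P. height (G z) = t) \<and> a \<in> P \<and> b \<in> P \<and>
      a \<in> sphere 0 1 \<and> b \<in> sphere 0 1 \<and> e \<le> dist (f (G a)) (f (G b))"
    if t: "0 < t" "t < s" "s - e \<le> t" for t
  proof -
    have "height (G (-1)) < t" "t < height (G 1)"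
      using t \<open>s \<le> height x\<close> by (auto simp: ends height_base)
    from separating_level_component[OF conth this] obtain P where
      P: "connected P" "\<And>q. q \<in> P \<Longrightarrow> height (G q) = t"
        "\<And>T. connected T \<Longrightarrow> -1 \<in> T \<Longrightarrow> 1 \<in> T \<Longrightarrow> T \<inter> P \<noteq> {}" by blast
    obtain a where a: "a \<in> sphere 0 1" "0 \<le> Im a" "a \<in> P"
      using P(3)[OF connected_half_circles(1)] by auto
    obtain b where b: "b \<in> sphere 0 1" "Im b \<le> 0" "b \<in> P"
      using P(3)[OF connected_half_circles(2)] by auto
    have "dist (f (G a)) (f x) \<le> height x + e - t"
      using upper[OF a(1,2)] P(2)[OF a(3)] unfolding A_def by simp
    moreover have "dist (f (G b)) (f y) \<le> height y + e - t"
      using lower[OF b(1,2)] P(2)[OF b(3)] t(2) unfolding B_def by auto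
    moreover have "dist (f x) (f y) \<le> dist (f (G a)) (f x) + dist (f (G a)) (f (G b)) + dist (f (G b)) (f y)"
      by metric
    ultimately have "e \<le> dist (f (G a)) (f (G b))" using e t(3) by linarith
    then show ?thesis using P(1,2) a b by blast
  qed
  \<comment> \<open>Infinitely many distinct levels in the range allowed by \<open>crossing\<close>;
    the summand 2 makes the offset at most \<open>s / 2\<close>, so all are positive.\<close>
  define t where "t n = s - min e s / (real n + 2)" for n
  have t: "0 < t n" "t n < s" "s - e \<le> t n" for n
  proof -
    have m: "0 < min e s" using e(1) s by simp
    then show "t n < s" by (simp add: t_def)
    have "min e s / (real n + 2) \<le> min e s / 2" using m by (intro divide_left_mono) auto
    then show "0 < t n" "s - e \<le> t n" using m unfolding t_def by linarith+
  qed
  have inj: "m = n" if "t m = t n" for m n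
    using that e(1) s unfolding t_def by (simp add: min_def split: if_splits)
  obtain P a b where P: "\<And>n. connected (P n)" "\<And>n z. z \<in> P n \<Longrightarrow> height (G z) = t n" "\<And>n. a n \<in> P n" "\<And>n. b n \<in> P n"
      and circ: "\<And>n. a n \<in> sphere 0 1" "\<And>n. b n \<in> sphere 0 1" and far: "\<And>n. e \<le> dist (f (G (a n))) (f (G (b n)))"
    using crossing[OF t] by metis
  have mem: "\<forall>n. (a n, b n) \<in> sphere 0 1 \<times> sphere 0 1" using circ by simp
  \<comment> \<open>By compactness, infinitely many pairs of crossing points accumulate at one pair.
    Two of the components then cross between the same two small balls, as
    \<open>level_crossings_eq\<close> requires.\<close>
  have "seq_compact (sphere (0::complex) 1 \<times> sphere (0::complex) 1)"
    by (intro compact_imp_seq_compact compact_Times compact_sphere)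
  then obtain l r where r: "strict_mono r" and l: "((\<lambda>n. (a n, b n)) \<circ> r) \<longlonglongrightarrow> l"
    by (rule seq_compactE[OF _ mem])
  define a' b' where "a' = fst l" and "b' = snd l"
  have lim: "(\<lambda>n. a (r n)) \<longlonglongrightarrow> a'" "(\<lambda>n. b (r n)) \<longlonglongrightarrow> b'"
    using tendsto_fst[OF l] tendsto_snd[OF l] by (simp_all add: a'_def b'_def o_def)
  have contF: "isCont (\<lambda>z. f (G z)) z" for z
    using continuous_on_compose2[OF lipschitz_on_continuous_on[OF f_lip] contG]
    by (simp add: continuous_on_eq_continuous_at)
  have "(\<lambda>n. dist (f (G (a (r n)))) (f (G (b (r n))))) \<longlonglongrightarrow> dist (f (G a')) (f (G b'))"
    by (intro tendsto_dist isCont_tendsto_compose[OF contF] lim)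
  then have e': "e \<le> dist (f (G a')) (f (G b'))"
    by (rule LIMSEQ_le_const) (use far in auto)
  have nbhd: "\<exists>d>0. \<forall>z\<in>ball w d. dist (f (G w)) (f (G z)) < e/3" for w
    using contF[of w] e(1) unfolding continuous_at_eps_delta
    by (metis dist_commute divide_pos_pos mem_ball zero_less_numeral)
  obtain d1 where d1: "0 < d1" "\<And>z. z \<in> ball a' d1 \<Longrightarrow> dist (f (G a')) (f (G z)) < e/3" using nbhd by blast
  obtain d2 where d2: "0 < d2" "\<And>z. z \<in> ball b' d2 \<Longrightarrow> dist (f (G b')) (f (G z)) < e/3" using nbhd by blast
  have "eventually (\<lambda>n. a (r n) \<in> ball a' d1 \<and> b (r n) \<in> ball b' d2) sequentially"
    using d1(1) d2(1) by (intro eventually_conj topological_tendstoD[OF lim(1)] topological_tendstoD[OF lim(2)]) auto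
  then obtain N where N: "\<And>n. N \<le> n \<Longrightarrow> a (r n) \<in> ball a' d1 \<and> b (r n) \<in> ball b' d2"
    unfolding eventually_sequentially by blast
  have "t (r N) = t (r (Suc N))"
  proof (rule level_crossings_eq[where A = "ball a' d1" and B = "ball b' d2" and P = "P (r N)" and P' = "P (r (Suc N))",
        OF contG compact null e(1) e'])
    have "a (r N) \<in> P (r N) \<inter> ball a' d1" "b (r N) \<in> P (r N) \<inter> ball b' d2"
      "a (r (Suc N)) \<in> P (r (Suc N)) \<inter> ball a' d1" "b (r (Suc N)) \<in> P (r (Suc N)) \<inter> ball b' d2"
      using N[of N] N[of "Suc N"] P(3,4) by simp_all
    then show "P (r N) \<inter> ball a' d1 \<noteq> {}" "P (r N) \<inter> ball b' d2 \<noteq> {}"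
      "P (r (Suc N)) \<inter> ball a' d1 \<noteq> {}" "P (r (Suc N)) \<inter> ball b' d2 \<noteq> {}"
      by (blast intro: ex_in_conv[THEN iffD1])+
  qed (simp_all only: d1 d2 P(1,2) centre_in_ball connected_ball)
  then have "r N = r (Suc N)" by (rule inj)
  then show False using r by (simp add: strict_mono_eq)
qed

lemma f_dist_le_tdist: "dist (f x) (f y) \<le> tdist x y"
proof -
  have "meet x y \<le> (height x + height y - dist (f x) (f y)) / 2"
    by (rule meet_least) (use f_dist_le_levels in fastforce)
  then show ?thesis by (simp add: tdist_def)
qed

end

theorem theorem7:
  fixes C :: real and f :: "'a::metric_space \<Rightarrow> 'b::metric_space"
  assumes "quasi_convex C TYPE('a)"
    and "lip_simply_connected TYPE('a)"
    and "purely_2_unrectifiable TYPE('b)"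
    and "\<exists>L. lipschitz_on L UNIV f"
  shows "\<exists>(Z :: ('a \<times> 'a \<times> real) set) dZ \<psi> \<phi>.
           metric_tree Z dZ \<and>
           \<psi> ` UNIV \<subseteq> Z \<and>
           (\<forall>x x'. dZ (\<psi> x) (\<psi> x') \<le> C * Lip f * dist x x') \<and>
           (\<forall>p\<in>Z. \<forall>q\<in>Z. dist (\<phi> p) (\<phi> q) \<le> dZ p q) \<and>
           f = \<phi> \<circ> \<psi>"
proof -
  \<comment> \<open>Any base point will do.\<close>
  interpret disc_filling f "Lip f" C undefined
  proof
    show "lipschitz_on (Lip f) UNIV f" by (rule lipschitz_on_Lip[OF assms(4)])
    show "\<exists>\<gamma> :: real \<Rightarrow> 'a. lipschitz_on (C * dist x y) {0..1} \<gamma> \<and> \<gamma> 0 = x \<and> \<gamma> 1 = y" for x y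
      using quasi_convex_lipschitz_path[OF assms(1)] by metis
    show "\<exists>g L'. lipschitz_on L' (cball 0 1) g \<and> (\<forall>z\<in>sphere 0 1. g z = \<gamma> z)"
      if "lipschitz_on L (sphere 0 1) \<gamma>" for \<gamma> :: "complex \<Rightarrow> 'a" and L
      using assms(2) that unfolding lip_simply_connected_def by blast
  qed (rule assms(3))
  \<comment> \<open>At pseudo-distance 0 the defining predicates coincide, so \<open>SOME\<close>
    returns one representative per class.\<close>
  define rep where "rep x = (SOME y. tdist x y = 0)" for x
  have rep: "tdist x (rep x) = 0" for x
    unfolding rep_def by (rule someI[of _ x]) (rule tdist_refl)
  have tdist_rep: "tdist (rep x) (rep y) = tdist x y" for x y
    using tdist_triangle[of "rep x" "rep y" x] tdist_triangle[of x "rep y" y]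
      tdist_triangle[of x y "rep x"] tdist_triangle[of "rep x" y "rep y"]
      rep[of x] rep[of y] tdist_commute[of x "rep x"] tdist_commute[of y "rep y"] by linarith
  have rep_eq: "rep x = rep y" if "tdist x y = 0" for x y
  proof -
    have "tdist x z = tdist y z" for z
      using that tdist_triangle[of x z y] tdist_triangle[of y z x] tdist_commute[of x y] by linarith
    then show ?thesis unfolding rep_def by simp
  qed
  \<comment> \<open>The representatives are embedded in the product type by padding with a copy and
    0.\<close>
  define \<psi> where "\<psi> x = (rep x, rep x, 0::real)" for x
  define \<phi> where "\<phi> = (\<lambda>z :: 'a \<times> 'a \<times> real. f (fst z))"
  define dZ where "dZ = (\<lambda>(z :: 'a \<times> 'a \<times> real) (w :: 'a \<times> 'a \<times> real). tdist (fst z) (fst w))"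
  have d\<psi>: "dZ (\<psi> x) (\<psi> y) = tdist x y" for x y by (simp add: dZ_def \<psi>_def tdist_rep)
  interpret Z: four_point_space "range \<psi>" dZ
  proof
    show "0 \<le> dZ z w" "dZ z w = dZ w z" for z w by (auto simp: dZ_def tdist_nonneg tdist_commute)
    show "dZ z w = 0 \<longleftrightarrow> z = w" if "z \<in> range \<psi>" "w \<in> range \<psi>" for z w
      using that rep_eq by (auto simp: d\<psi> tdist_refl) (simp add: \<psi>_def)
    show "dZ u w \<le> dZ u v + dZ v w" for u v w by (simp add: dZ_def tdist_triangle)
    show "dZ u v + dZ w z \<le> max (dZ u w + dZ v z) (dZ u z + dZ v w)" for u v w z
      unfolding dZ_def by (rule tdist_four_point)
    show "\<exists>v\<in>range \<psi>. dZ u v = s \<and> dZ v w = dZ u w - s"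
      if uw: "u \<in> range \<psi>" "w \<in> range \<psi>" and s: "0 \<le> s" "s \<le> dZ u w" for u w s
    proof -
      obtain x y where xy: "u = \<psi> x" "w = \<psi> y" using uw by blast
      obtain z where "tdist x z = s" "tdist z y = tdist x y - s"
        using tdist_between[of s x y] s by (auto simp: xy d\<psi>)
      then show ?thesis by (auto simp: xy d\<psi> intro!: bexI[of _ "\<psi> z"])
    qed
  qed
  \<comment> \<open>Because \<open>tdist\<close> dominates the distance of the images,
    \<open>f\<close> is constant on classes and descends to the quotient.\<close>
  have "f (rep x) = f x" for x
    using f_dist_le_tdist[of x "rep x"] rep[of x] by simp
  then have "f = \<phi> \<circ> \<psi>" by (auto simp: \<phi>_def \<psi>_def)
  moreover have "dZ (\<psi> x) (\<psi> y) \<le> C * Lip f * dist x y" for x y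
    using tdist_le[of x y] by (simp add: d\<psi> mult_ac)
  moreover have "dist (\<phi> z) (\<phi> w) \<le> dZ z w" for z w
    unfolding \<phi>_def dZ_def by (rule f_dist_le_tdist)
  ultimately show ?thesis using Z.metric_tree by blast
qed

end
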